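(* Let $r\ge1$, let $\lambda=(\lambda_1\ge\cdots\ge\lambda_r\ge0)$ be a partition, let $\mathbf c,\mathbf d$ be proper flags, and write $\mathbf d=w\mathbf c_0$ with $w\in W=S_r$. Let $s_i=(i,i+1)\in W$ be a simple reflection. Then $$Z(\mathfrak S_{\lambda,\mathbf c,s_i\mathbf d}(\mathbf z;t))=\begin{cases}\mathcal L_{i,t}\,Z(\mathfrak S_{\lambda,\mathbf c,\mathbf d}(\mathbf z;t))&\text{if } s_iw>w,\\ \mathcal L_{i,t}^{-1}\,Z(\mathfrak S_{\lambda,\mathbf c,\mathbf d}(\mathbf z;t))&\text{if } s_iw<w.\end{cases}$$
   Context: $<$ is the Bruhat order on $S_r$ ($s_iw>w$ iff $\ell(s_iw)>\ell(w)$). $\mathbf z=(z_1,\dots,z_r)$, $\mathbf z^{\alpha_i}=z_i/z_{i+1}$, and $s_i\mathbf z$ is $\mathbf z$ with $z_i,z_{i+1}$ interchanged. The Demazure-Lusztig operator on Laurent polynomials in $\mathbf z$ (with coefficients Laurent polynomials in $t$) is $$\mathcal L_{i,t}f(\mathbf z)=\frac{f(\mathbf z)-f(s_i\mathbf z)}{\mathbf z^{\alpha_i}-1}-t\,\frac{f(\mathbf z)-\mathbf z^{\alpha_i}f(s_i\mathbf z)}{\mathbf z^{\alpha_i}-1};$$ it satisfies $\mathcal L_{i,t}^2=(t-1)\mathcal L_{i,t}+t$, hence is invertible. Flags. Fix colors $\gamma_1>\gamma_2>\cdots>\gamma_r$. A flag is a sequence $\mathbf c=(c_1,\dots,c_r)$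 of colors; it is proper if its entries are distinct. $S_r$ acts by $(w\mathbf c)_i=c_{w^{-1}(i)}$. The standard flag is $\mathbf c_0=(\gamma_1,\dots,\gamma_r)$. Colored weights. Horizontal spins are $\{+,\gamma_1,\dots,\gamma_r\}$; vertical spins are multisets $\gamma_1^{m_1}\cdots\gamma_r^{m_r}$ with $m_k\in\mathbb N$. Vertex spins are listed in the order (left, top, right, bottom). The monochrome vertex of type $(z,g)$ ($g$ a color) has vertical spins in $\mathbb N$ and weights, for $n\in\mathbb N$: $(+,n,+,n)$: $1$; $(h,n,h,n)$ for a color $h$: $1$ if $g<h$, $z$ if $g=h$, $t^n$ if $g>h$; $(g,n,+,n+1)$: $P$-weight $z(1-t^{n+1})$, $R$-weight $z(1-t)$; $(+,n+1,g,n)$: $P$-weight $1$, $R$-weight $\frac{1-t^{n+1}}{1-t}$; all others $0$. The colored weight of a vertex with parameter $z$ and spins $(a,\ \gamma_1^{b_1}\cdots\gamma_r^{b_r},\ c,\ \gamma_1^{d_1}\cdots\gamma_r^{d_r})$ is the partition function of a row of monochrome vertices of types $(z,\gamma_r),(z,\gamma_{r-1}),\dots,(z,\gamma_1)$ from left to right, the one of color $\gamma_k$ having top spin $b_k$ and bottom spin $d_k$, with leftmost spin $a$, rightmost spin $c$, summed over interior horizontal spins. System. For flags $\mathbf c,\mathbf d$ and $N\ge\lambda_1$, $\mathfrak S_{\lambda,\mathbf c,\mathbf d}(\mathbf z;t)$ is the model on a grid with $r$ rows (labeled $1,\dots,r$ top to bottom, row $i$ using parameter $z_i$) and $N+1$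 columns (labeled $0,\dots,N$ from right to left), with boundary spins: left edges $+$; right edge of row $i$: $d_i$; bottom edges: the empty multiset; top edge of column $j$: the multiset in which $\gamma_k$ has multiplicity $\#\{i:\lambda_i=j,\ c_i=\gamma_k\}$. $Z$ is the sum over all assignments of spins to interior edges of the product of the colored vertex weights; it is independent of $N$. For proper flags the $P$- and $R$-weights give the same partition function, and $Z$ denotes this common value. *)

theory Defs
  imports
    "HOL-Library.Poly_Mapping"
    "HOL-Library.Multiset"
    "HOL-Library.FuncSet"
    "HOL-Combinatorics.Permutations"
begin

section \<open>Laurent polynomials and the Demazure--Lusztig operators\<close>

text \<open>
  Laurent polynomials in \<open>z\<^sub>1, z\<^sub>2, \<dots>\<close> whose coefficients are Laurent polynomials in \<open>t\<close>
  over a coefficient domain \<open>'a\<close>. An exponent vector is a finitely supported map from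
  variable indices to integers; multiplication is convolution.
\<close>

type_synonym 'a laurent = "(nat \<Rightarrow>\<^sub>0 int) \<Rightarrow>\<^sub>0 (int \<Rightarrow>\<^sub>0 'a)"

definition laurents :: "nat \<Rightarrow> 'a::idom laurent set" where
  "laurents r = {f. \<forall>m \<in> Poly_Mapping.keys f. Poly_Mapping.keys m \<subseteq> {1..r}}"

definition tvar :: "'a::idom laurent" where
  "tvar = Poly_Mapping.single 0 (Poly_Mapping.single 1 1)"

definition zvar :: "nat \<Rightarrow> 'a::idom laurent" where
  "zvar k = Poly_Mapping.single (Poly_Mapping.single k 1) 1"

definition zalpha :: "nat \<Rightarrow> 'a::idom laurent" where
  "zalpha i =
     Poly_Mapping.single (Poly_Mapping.single i 1 - Poly_Mapping.single (i + 1) 1) 1"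

abbreviation simple_refl :: "nat \<Rightarrow> nat \<Rightarrow> nat" where
  "simple_refl i \<equiv> Transposition.transpose i (i + 1)"

text \<open>
  The substitution \<open>f(z) \<mapsto> f(s\<^sub>i z)\<close>: the coefficient of the result at an exponent vector
  \<open>m\<close> is the coefficient of \<open>f\<close> at \<open>m \<circ> s\<^sub>i\<close>, as \<open>map_key\<close> is precomposition.
\<close>

definition swap_vars :: "nat \<Rightarrow> 'a::idom laurent \<Rightarrow> 'a laurent" where
  "swap_vars i f = Poly_Mapping.map_key (Poly_Mapping.map_key (simple_refl i)) f"

text \<open>
  The quotient \<open>x / y\<close> inside an integral domain; it is unspecified unless \<open>y\<close> is nonzero
  and divides \<open>x\<close>, and is only used for divisions that are exact.
\<close>

definition exact_div :: "'b::idom \<Rightarrow> 'b \<Rightarrow> 'b" where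
  "exact_div x y = (THE q. q * y = x)"

definition demazure_lusztig :: "nat \<Rightarrow> 'a::idom laurent \<Rightarrow> 'a laurent" where
  "demazure_lusztig i f =
     exact_div (f - swap_vars i f) (zalpha i - 1)
       - tvar * exact_div (f - zalpha i * swap_vars i f) (zalpha i - 1)"

text \<open>The inverse of the operator on Laurent polynomials in \<open>z\<^sub>1, \<dots>, z\<^sub>r\<close>.\<close>

definition demazure_lusztig_inv :: "nat \<Rightarrow> nat \<Rightarrow> 'a::idom laurent \<Rightarrow> 'a laurent" where
  "demazure_lusztig_inv r i = inv_into (laurents r) (demazure_lusztig i)"


section \<open>The symmetric group and its Bruhat order\<close>

text \<open>\<open>S\<^sub>r\<close> is the set of all \<open>w\<close> with \<open>w permutes {1..r}\<close>, with product \<open>\<circ>\<close>.\<close>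

definition cox_length :: "nat \<Rightarrow> (nat \<Rightarrow> nat) \<Rightarrow> nat" where
  "cox_length r w =
     (LEAST n. \<exists>is. length is = n \<and> set is \<subseteq> {1..<r} \<and> w = foldr (\<lambda>i u. simple_refl i \<circ> u) is id)"

definition bruhat_step :: "nat \<Rightarrow> (nat \<Rightarrow> nat) \<Rightarrow> (nat \<Rightarrow> nat) \<Rightarrow> bool" where
  "bruhat_step r u v \<longleftrightarrow>
     u permutes {1..r} \<and>
     (\<exists>a b. 1 \<le> a \<and> a < b \<and> b \<le> r \<and> v = Transposition.transpose a b \<circ> u) \<and>
     cox_length r u < cox_length r v"

definition bruhat_less :: "nat \<Rightarrow> (nat \<Rightarrow> nat) \<Rightarrow> (nat \<Rightarrow> nat) \<Rightarrow> bool" where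
  "bruhat_less r = (bruhat_step r)\<^sup>+\<^sup>+"


section \<open>Flags\<close>

text \<open>
  The colors are \<open>\<gamma> 1 > \<dots> > \<gamma> r\<close> in a linearly ordered type; a flag is a function of which
  only the values on \<open>{1..r}\<close> matter.
\<close>

definition proper_flag :: "nat \<Rightarrow> (nat \<Rightarrow> 'c) \<Rightarrow> (nat \<Rightarrow> 'c) \<Rightarrow> bool" where
  "proper_flag r \<gamma> c \<longleftrightarrow> c ` {1..r} \<subseteq> \<gamma> ` {1..r} \<and> inj_on c {1..r}"

definition flag_act :: "(nat \<Rightarrow> nat) \<Rightarrow> (nat \<Rightarrow> 'c) \<Rightarrow> nat \<Rightarrow> 'c" where
  "flag_act w c = (\<lambda>i. c (inv w i))"


section \<open>Weights\<close>

datatype 'c hspin = Plus | Col 'c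

datatype weight_kind = P_weight | R_weight

definition hspins :: "nat \<Rightarrow> (nat \<Rightarrow> 'c) \<Rightarrow> 'c hspin set" where
  "hspins r \<gamma> = insert Plus (Col ` \<gamma> ` {1..r})"

definition vspins :: "nat \<Rightarrow> (nat \<Rightarrow> 'c) \<Rightarrow> 'c multiset set" where
  "vspins r \<gamma> = {M. set_mset M \<subseteq> \<gamma> ` {1..r}}"

text \<open>
  Monochrome vertex of type \<open>(z, g)\<close>; the spins are listed in the order left, top, right,
  bottom.
\<close>

fun mono_weight ::
  "weight_kind \<Rightarrow> 'a::idom laurent \<Rightarrow> 'c::linorder \<Rightarrow> 'c hspin \<Rightarrow> nat \<Rightarrow> 'c hspin \<Rightarrow> nat \<Rightarrow> 'a laurent"
where
  "mono_weight \<kappa> z g Plus n Plus m = (if m = n then 1 else 0)"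
| "mono_weight \<kappa> z g (Col h) n (Col h') m =
     (if h' = h \<and> m = n then (if g < h then 1 else if g = h then z else tvar ^ n) else 0)"
| "mono_weight \<kappa> z g (Col h) n Plus m =
     (if h = g \<and> m = n + 1 then
        (case \<kappa> of P_weight \<Rightarrow> z * (1 - tvar ^ (n + 1)) | R_weight \<Rightarrow> z * (1 - tvar))
      else 0)"
| "mono_weight \<kappa> z g Plus n (Col h) m =
     (if h = g \<and> n = m + 1 then
        (case \<kappa> of P_weight \<Rightarrow> 1 | R_weight \<Rightarrow> exact_div (1 - tvar ^ (m + 1)) (1 - tvar))
      else 0)"

text \<open>
  A colored vertex is a row of monochrome vertices of colors \<open>\<gamma> r, \<dots>, \<gamma> 1\<close> from left to
  right; the one of color \<open>\<gamma> k\<close> has left edge \<open>e k\<close> and right edge \<open>e (k - 1)\<close>, so that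
  \<open>e r\<close> and \<open>e 0\<close> are the outer edges.
\<close>

definition row_states ::
  "nat \<Rightarrow> (nat \<Rightarrow> 'c) \<Rightarrow> 'c hspin \<Rightarrow> 'c hspin \<Rightarrow> (nat \<Rightarrow> 'c hspin) set"
where
  "row_states r \<gamma> a c = {e \<in> {0..r} \<rightarrow>\<^sub>E hspins r \<gamma>. e r = a \<and> e 0 = c}"

definition colored_weight ::
  "weight_kind \<Rightarrow> nat \<Rightarrow> (nat \<Rightarrow> 'c::linorder) \<Rightarrow> 'a::idom laurent \<Rightarrow>
   'c hspin \<Rightarrow> 'c multiset \<Rightarrow> 'c hspin \<Rightarrow> 'c multiset \<Rightarrow> 'a laurent"
where
  "colored_weight \<kappa> r \<gamma> z a B c D =
     (\<Sum>e \<in> row_states r \<gamma> a c.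
        \<Prod>k = 1..r. mono_weight \<kappa> z (\<gamma> k) (e k) (count B (\<gamma> k)) (e (k - 1)) (count D (\<gamma> k)))"


section \<open>The lattice model\<close>

text \<open>
  The vertex in row \<open>i \<in> {1..r}\<close> and column \<open>j \<in> {0..N}\<close> has left edge \<open>H (i, j + 1)\<close>, top
  edge \<open>V (i - 1, j)\<close>, right edge \<open>H (i, j)\<close> and bottom edge \<open>V (i, j)\<close> (columns are
  numbered from right to left). A state assigns spins to all edges, with the prescribed
  values on the boundary.
\<close>

definition top_spin :: "nat \<Rightarrow> (nat \<Rightarrow> nat) \<Rightarrow> (nat \<Rightarrow> 'c) \<Rightarrow> nat \<Rightarrow> 'c multiset" where
  "top_spin r lam c j = image_mset c (mset_set {i \<in> {1..r}. lam i = j})"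

definition states ::
  "nat \<Rightarrow> (nat \<Rightarrow> 'c) \<Rightarrow> nat \<Rightarrow> (nat \<Rightarrow> nat) \<Rightarrow> (nat \<Rightarrow> 'c) \<Rightarrow> (nat \<Rightarrow> 'c) \<Rightarrow>
   ((nat \<times> nat \<Rightarrow> 'c hspin) \<times> (nat \<times> nat \<Rightarrow> 'c multiset)) set"
where
  "states r \<gamma> N lam c d =
     {(H, V).
        H \<in> {1..r} \<times> {0..N+1} \<rightarrow>\<^sub>E hspins r \<gamma> \<and>
        V \<in> {0..r} \<times> {0..N} \<rightarrow>\<^sub>E vspins r \<gamma> \<and>
        (\<forall>i \<in> {1..r}. H (i, N + 1) = Plus \<and> H (i, 0) = Col (d i)) \<and>
        (\<forall>j \<in> {0..N}. V (0, j) = top_spin r lam c j \<and> V (r, j) = {#})}"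

definition state_weight ::
  "weight_kind \<Rightarrow> nat \<Rightarrow> (nat \<Rightarrow> 'c::linorder) \<Rightarrow> nat \<Rightarrow>
   (nat \<times> nat \<Rightarrow> 'c hspin) \<times> (nat \<times> nat \<Rightarrow> 'c multiset) \<Rightarrow> 'a::idom laurent"
where
  "state_weight \<kappa> r \<gamma> N = (\<lambda>(H, V).
     \<Prod>i = 1..r. \<Prod>j = 0..N.
       colored_weight \<kappa> r \<gamma> (zvar i) (H (i, j + 1)) (V (i - 1, j)) (H (i, j)) (V (i, j)))"

text \<open>
  There are infinitely many states, as multiplicities are unbounded. The sum is restricted
  to those of nonzero weight, of which there are finitely many because every vertex of
  nonzero weight conserves colors.
\<close>

definition partition_function ::
  "weight_kind \<Rightarrow> nat \<Rightarrow> (nat \<Rightarrow> 'c::linorder) \<Rightarrow> nat \<Rightarrow> (nat \<Rightarrow> nat) \<Rightarrow>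
   (nat \<Rightarrow> 'c) \<Rightarrow> (nat \<Rightarrow> 'c) \<Rightarrow> 'a::idom laurent"
where
  "partition_function \<kappa> r \<gamma> N lam c d =
     (\<Sum>s | s \<in> states r \<gamma> N lam c d \<and> state_weight \<kappa> r \<gamma> N s \<noteq> (0 :: 'a laurent).
        state_weight \<kappa> r \<gamma> N s)"

end

theory Submission
  imports Defs
begin

text \<open>
  Rows \<open>i\<close> and \<open>i + 1\<close>, with parameters \<open>x\<close> and \<open>y\<close>, are isolated from the rest of the grid, and
  the pair of vectors \<open>(v, v')\<close> of two-row partition functions for parameters \<open>(x, y)\<close> and \<open>(y, x)\<close>,
  indexed by the pair of spins on the right, is followed through the monochrome columns from left to
  right. The train argument amounts to an invariant: for each pair of distinct spins,
  \<open>v\<close> and \<open>v'\<close> are tied by the two linear relations encoded by the R-matrix, whose normalisation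
  depends on which colors have already been passed in the current colored column. At the right
  boundary this relation says exactly that exchanging \<open>d\<^sub>i > d\<^sub>i\<^sub>+\<^sub>1\<close> applies the Demazure--Lusztig
  operator. The case \<open>s\<^sub>i w < w\<close> follows because the operator is injective.
\<close>

text \<open>The relation is carried by vectors with all denominators cleared, so that no R-matrix
  has to be inverted and no field of fractions is needed. At the left boundary both vectors are the
  unit vector at (\<open>Plus\<close>, \<open>Plus\<close>): the diagonal entries agree and every
  other relation reads 0 = 0. Each column then sends related vectors to related vectors.

  Both linear relations must travel together. In its own column a color trades places with the other
  spin, so the system has to be solved for its other pair of unknowns. Its determinant is t (x -
  y)^2, and cancelling factors of it is where x and y must differ and t must be nonzero.

  The second obstacle is that vertical multiplicities are unbounded. They are cut off at a bound
  \<open>B\<close>, but then a column sum is exact only if \<open>B\<close> exceeds the multiplicity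
  on top, and this must hold for the same \<open>B\<close> in both orders of the two parameters.

  The Bruhat order enters only through lengths: if s_i w is longer than w, then the inverse of w
  takes a smaller value at i than at i + 1, that is, d_i > d_{i+1}.\<close>

section \<open>Laurent polynomials and the Demazure--Lusztig operators\<close>

text \<open>Reduces additive statements to monomials; zero is covered as a monomial with coefficient
  0.\<close>

lemma poly_mapping_single_induct [case_names single add]:
  fixes f :: "'m \<Rightarrow>\<^sub>0 'b::comm_monoid_add"
  assumes "\<And>m c. P (Poly_Mapping.single m c)"
    and "\<And>f g. P f \<Longrightarrow> P g \<Longrightarrow> P (f + g)"
  shows "P f"
proof (induction f rule: Poly_Mapping.update_induct)
  case const
  show ?case using assms(1)[of undefined 0] by simp
next
  case (update f a b)
  have "Poly_Mapping.update a b f = f + Poly_Mapping.single a b"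
    using update
    by (intro poly_mapping_eqI)
       (auto simp: lookup_update lookup_add lookup_single when_def in_keys_iff)
  with update assms show ?case by simp
qed

section \<open>The substitution that exchanges two variables\<close>

definition swap_exp :: "nat \<Rightarrow> (nat \<Rightarrow>\<^sub>0 int) \<Rightarrow> (nat \<Rightarrow>\<^sub>0 int)" where
  "swap_exp i = Poly_Mapping.map_key (simple_refl i)"

lemma inj_simple_refl: "inj (simple_refl i)"
  by (rule inj_on_transpose)

lemma swap_exp_involutive: "swap_exp i (swap_exp i m) = m"
proof -
  have "simple_refl i \<circ> simple_refl i = (\<lambda>x. x)"
    by auto
  then show ?thesis
    unfolding swap_exp_def
    by (simp only: map_key_compose[OF inj_simple_refl inj_simple_refl] map_key_id)
qed

lemma inj_swap_exp: "inj (swap_exp i)"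
  by (rule inj_on_inverseI[of _ "swap_exp i"]) (rule swap_exp_involutive)

lemma swap_exp_add: "swap_exp i (m + n) = swap_exp i m + swap_exp i n"
  unfolding swap_exp_def by (rule map_key_plus[OF inj_simple_refl])

lemma swap_exp_single: "swap_exp i (Poly_Mapping.single k v) = Poly_Mapping.single (simple_refl i k) v"
  using map_key_single[OF inj_simple_refl, of i "simple_refl i k" v]
  by (simp add: swap_exp_def)

lemma swap_vars_single:
  "swap_vars i (Poly_Mapping.single m c) = Poly_Mapping.single (swap_exp i m) c"
  unfolding swap_vars_def swap_exp_def[symmetric]
  using map_key_single[OF inj_swap_exp, of i "swap_exp i m" c] by (simp only: swap_exp_involutive)

lemma swap_vars_add: "swap_vars i (f + g) = swap_vars i f + swap_vars i g"
  unfolding swap_vars_def swap_exp_def[symmetric] by (rule map_key_plus[OF inj_swap_exp])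

lemma swap_vars_0 [simp]: "swap_vars i 0 = 0"
  unfolding swap_vars_def swap_exp_def[symmetric] by (rule map_key_zero[OF inj_swap_exp])

lemma swap_vars_uminus: "swap_vars i (- f) = - swap_vars i f"
  using swap_vars_add[of i f "- f"] by (simp add: eq_neg_iff_add_eq_0 add.commute)

lemma swap_vars_diff: "swap_vars i (f - g) = swap_vars i f - swap_vars i g"
  using swap_vars_add[of i f "- g"] by (simp add: swap_vars_uminus)

lemma swap_vars_mult: "swap_vars i (f * g) = swap_vars i f * swap_vars i g"
proof (induction f rule: poly_mapping_single_induct)
  case (single m c)
  show ?case
    by (induction g rule: poly_mapping_single_induct)
       (simp_all add: mult_single swap_vars_single swap_exp_add swap_vars_add distrib_left)
qed (simp add: swap_vars_add distrib_right)

lemma swap_exp_0: "swap_exp i 0 = 0"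
  unfolding swap_exp_def by (rule map_key_zero[OF inj_simple_refl])

lemma swap_vars_1 [simp]: "swap_vars i 1 = 1"
  using swap_vars_single[of i 0 1] by (simp add: swap_exp_0)

lemma swap_vars_tvar [simp]: "swap_vars i tvar = tvar"
  by (simp add: tvar_def swap_vars_single swap_exp_0)

lemma swap_vars_power: "swap_vars i (f ^ n) = swap_vars i f ^ n"
  by (induction n) (simp_all add: swap_vars_mult)

lemma swap_vars_zvar: "swap_vars i (zvar k) = zvar (simple_refl i k)"
  by (simp add: zvar_def swap_vars_single swap_exp_single)

lemma swap_vars_sum: "swap_vars i (\<Sum>x\<in>A. f x) = (\<Sum>x\<in>A. swap_vars i (f x))"
  by (induction A rule: infinite_finite_induct) (simp_all add: swap_vars_add)

lemma swap_vars_prod: "swap_vars i (\<Prod>x\<in>A. f x) = (\<Prod>x\<in>A. swap_vars i (f x))"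
  by (induction A rule: infinite_finite_induct) (simp_all add: swap_vars_mult)

lemma swap_vars_involutive: "swap_vars i (swap_vars i f) = f"
  by (induction f rule: poly_mapping_single_induct)
     (simp_all add: swap_vars_single swap_exp_involutive swap_vars_add)

lemma tvar_neq_0: "(tvar :: 'a::idom laurent) \<noteq> 0"
  unfolding tvar_def by (metis lookup_single_eq lookup_zero zero_neq_one)

lemma tvar_neq_1: "(tvar :: 'a::idom laurent) \<noteq> 1"
  unfolding tvar_def single_one[symmetric]
  by (metis lookup_single_eq lookup_single_not_eq zero_neq_one)

lemma zalpha_mult_zvar: "zalpha i * zvar (i + 1) = zvar i"
  by (simp add: zalpha_def zvar_def mult_single)

lemma zvar_neq_0: "(zvar k :: 'a::idom laurent) \<noteq> 0"
  unfolding zvar_def by (metis lookup_single_eq lookup_zero zero_neq_one)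

lemma inj_zvar: "(zvar j :: 'a::idom laurent) = zvar k \<longleftrightarrow> j = k"
proof
  assume "(zvar j :: 'a laurent) = zvar k"
  then have "(Poly_Mapping.single j 1 :: nat \<Rightarrow>\<^sub>0 int) = Poly_Mapping.single k 1"
    unfolding zvar_def by (metis lookup_single_eq lookup_single_not_eq zero_neq_one)
  then show "j = k"
    by (metis lookup_single_eq lookup_single_not_eq zero_neq_one)
qed simp

lemma zalpha_neq_1: "(zalpha i :: 'a::idom laurent) \<noteq> 1"
  using zalpha_mult_zvar[of i, where ?'a = 'a] inj_zvar[of i "i + 1", where ?'a = 'a] by auto

lemma swap_vars_zalpha: "zalpha i * swap_vars i (zalpha i) = (1 :: 'a::idom laurent)"
proof -
  have eq: "swap_vars i (zalpha i) * zvar i = (zvar (i + 1) :: 'a laurent)"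
    using arg_cong[OF zalpha_mult_zvar[of i], of "swap_vars i"]
    by (simp add: swap_vars_mult swap_vars_zvar)
  have "(zalpha i * swap_vars i (zalpha i)) * zvar i = zalpha i * (swap_vars i (zalpha i) * zvar i)"
    by (simp only: mult.assoc)
  also have "\<dots> = 1 * (zvar i :: 'a laurent)"
    by (simp only: eq zalpha_mult_zvar mult_1)
  finally show ?thesis
    using zvar_neq_0 mult_right_cancel by blast
qed

section \<open>Exact division and the Demazure--Lusztig operator without denominators\<close>

lemma exact_div_eqI:
  fixes x y :: "'b::idom"
  assumes "q * y = x" "y \<noteq> 0"
  shows "exact_div x y = q"
  unfolding exact_div_def using assms by (intro the_equality) auto

lemma exact_div_geometric:
  "exact_div (1 - tvar ^ n) (1 - tvar :: 'a::idom laurent) = (\<Sum>k<n. tvar ^ k)"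
proof (rule exact_div_eqI)
  show "(\<Sum>k<n. tvar ^ k) * (1 - tvar) = (1 - tvar ^ n :: 'a laurent)"
    by (subst one_diff_power_eq) (rule mult.commute)
  show "1 - tvar \<noteq> (0 :: 'a laurent)"
    using tvar_neq_1[where ?'a = 'a] by (metis eq_iff_diff_eq_0)
qed

lemma zalpha_power:
  "zalpha i ^ n =
    Poly_Mapping.single (Poly_Mapping.single i (int n) - Poly_Mapping.single (i + 1) (int n)) 1"
proof (induction n)
  case (Suc n)
  have "Poly_Mapping.single i 1 - Poly_Mapping.single (i + 1) 1
      + (Poly_Mapping.single i (int n) - Poly_Mapping.single (i + 1) (int n))
      = Poly_Mapping.single i (int (Suc n)) - Poly_Mapping.single (i + 1) (int (Suc n))"
    by (intro poly_mapping_eqI) (simp add: lookup_add lookup_minus lookup_single when_def)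
  with Suc show ?case by (simp add: zalpha_def mult_single)
qed simp

lemma zalpha_dvd_monomial_diff:
  fixes c :: "int \<Rightarrow>\<^sub>0 'a::idom"
  assumes "m = n + (Poly_Mapping.single i (int k) - Poly_Mapping.single (i + 1) (int k))"
  shows "(zalpha i - 1) dvd (Poly_Mapping.single m c - Poly_Mapping.single n c)"
proof -
  have "Poly_Mapping.single m c = Poly_Mapping.single n c * zalpha i ^ k"
    using assms by (simp add: zalpha_power mult_single)
  then have "Poly_Mapping.single m c - Poly_Mapping.single n c
      = Poly_Mapping.single n c * (zalpha i ^ k - 1)"
    by (simp add: algebra_simps)
  moreover have "(zalpha i - 1) dvd (zalpha i ^ k - 1 :: 'a laurent)"
    unfolding power_diff_1_eq by simp
  ultimately show ?thesis by simp
qed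

lemma lookup_swap_exp:
  "Poly_Mapping.lookup (swap_exp i m) k = Poly_Mapping.lookup m (simple_refl i k)"
  by (simp only: swap_exp_def map_key.rep_eq[OF inj_simple_refl] o_apply)

text \<open>A monomial and its swap differ by a power of \<open>zalpha i\<close> whose exponent is
  the difference of the exponents at \<open>i\<close> and \<open>i + 1\<close>. The sign of that
  difference decides which of the two is the other times a natural power.\<close>

lemma zalpha_dvd_diff_swap: "(zalpha i - 1) dvd (f - swap_vars i f)"
proof (induction f rule: poly_mapping_single_induct)
  case (single m c)
  let ?d = "Poly_Mapping.lookup m i - Poly_Mapping.lookup m (i + 1)"
  have lk: "Poly_Mapping.lookup m (simple_refl i k)
      = (if k = i then Poly_Mapping.lookup m (i + 1)
         else if k = i + 1 then Poly_Mapping.lookup m i else Poly_Mapping.lookup m k)" for k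
    by (simp add: transpose_def)
  show ?case
  proof (cases "?d \<ge> 0")
    case True
    then have "m = swap_exp i m
        + (Poly_Mapping.single i (int (nat ?d)) - Poly_Mapping.single (i + 1) (int (nat ?d)))"
      by (intro poly_mapping_eqI)
         (auto simp: lookup_add lookup_minus lookup_swap_exp lk lookup_single when_def)
    from zalpha_dvd_monomial_diff[OF this] show ?thesis
      by (simp only: swap_vars_single)
  next
    case False
    then have "swap_exp i m = m
        + (Poly_Mapping.single i (int (nat (- ?d))) - Poly_Mapping.single (i + 1) (int (nat (- ?d))))"
      by (intro poly_mapping_eqI)
         (auto simp: lookup_add lookup_minus lookup_swap_exp lk lookup_single when_def)
    from zalpha_dvd_monomial_diff[OF this, of c] show ?thesis
      unfolding swap_vars_single by (subst minus_diff_eq[symmetric]) (simp only: dvd_minus_iff)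
  qed
next
  case (add f g)
  have "f + g - swap_vars i (f + g) = (f - swap_vars i f) + (g - swap_vars i g)"
    by (simp add: swap_vars_add)
  with add show ?case by (simp only: dvd_add)
qed

text \<open>The first division is exact by \<open>zalpha_dvd_diff_swap\<close>. The second numerator
  is the first one minus \<open>(zalpha i - 1) * swap_vars i f\<close>, so it is divisible as
  well.\<close>

lemma demazure_lusztig_mult:
  fixes f :: "'a::idom laurent"
  shows "(zalpha i - 1) * demazure_lusztig i f
    = (f - swap_vars i f) - tvar * (f - zalpha i * swap_vars i f)"
proof -
  have nz: "zalpha i - 1 \<noteq> (0 :: 'a laurent)"
    using zalpha_neq_1[of i, where ?'a = 'a] by (metis eq_iff_diff_eq_0)
  obtain q where q: "f - swap_vars i f = (zalpha i - 1) * q"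
    using zalpha_dvd_diff_swap by blast
  have e1: "exact_div (f - swap_vars i f) (zalpha i - 1) = q"
    by (rule exact_div_eqI[OF _ nz]) (simp add: q mult.commute)
  have "f - zalpha i * swap_vars i f = (f - swap_vars i f) - (zalpha i - 1) * swap_vars i f"
    by (simp add: algebra_simps)
  then have e2: "f - zalpha i * swap_vars i f = (zalpha i - 1) * (q - swap_vars i f)"
    unfolding q by (simp add: algebra_simps)
  have e3: "exact_div (f - zalpha i * swap_vars i f) (zalpha i - 1) = q - swap_vars i f"
    by (rule exact_div_eqI[OF _ nz]) (simp add: e2 mult.commute)
  show ?thesis
    unfolding demazure_lusztig_def e1 e3 unfolding e2 q by (simp add: algebra_simps)
qed

text \<open>Multiplying by \<open>zvar (i + 1)\<close> turns \<open>zalpha i\<close> into a ratio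
  with cleared denominator; the hypothesis is then the first equation of \<open>exch\<close> with c
  = 1.\<close>

lemma demazure_lusztig_eqI:
  fixes f g :: "'a::idom laurent"
  assumes "(zvar i - zvar (i + 1)) * g
    = (1 - tvar) * zvar (i + 1) * f - (zvar (i + 1) - tvar * zvar i) * swap_vars i f"
  shows "demazure_lusztig i f = g"
proof -
  let ?y = "zvar (i + 1) :: 'a laurent" and ?a = "zalpha i :: 'a laurent"
  have "?y * ((?a - 1) * g) = (?a * ?y - ?y) * g"
    by (simp add: algebra_simps)
  also have "\<dots> = (1 - tvar) * ?y * f - (?y - tvar * (?a * ?y)) * swap_vars i f"
    using assms by (simp only: zalpha_mult_zvar)
  also have "\<dots> = ?y * ((f - swap_vars i f) - tvar * (f - ?a * swap_vars i f))"
    by (simp add: algebra_simps)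
  also have "\<dots> = ?y * ((?a - 1) * demazure_lusztig i f)"
    by (simp only: demazure_lusztig_mult)
  finally show ?thesis
    using zvar_neq_0[of "i + 1", where ?'a = 'a] zalpha_neq_1[of i, where ?'a = 'a] by auto
qed

text \<open>For the difference h of two elements with the same image, the resulting equation and its
  swap form a homogeneous linear system in h and its swap. Up to a unit its determinant is t (a -
  1)^2 with a = \<open>zalpha i\<close>, which is nonzero.\<close>

lemma inj_demazure_lusztig: "inj (demazure_lusztig i :: 'a::idom laurent \<Rightarrow> 'a laurent)"
proof (rule injI)
  fix f g :: "'a laurent"
  assume eq: "demazure_lusztig i f = demazure_lusztig i g"
  let ?a = "zalpha i :: 'a laurent" and ?t = "tvar :: 'a laurent"
  define b h s where "b = swap_vars i ?a" and "h = f - g" and "s = swap_vars i h"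
  have ab: "?a * b = 1"
    unfolding b_def by (rule swap_vars_zalpha)
  have "(f - swap_vars i f) - ?t * (f - ?a * swap_vars i f)
      = (g - swap_vars i g) - ?t * (g - ?a * swap_vars i g)"
    by (simp only: demazure_lusztig_mult[symmetric] eq)
  then have 1: "(1 - ?t) * h = (1 - ?t * ?a) * s"
    unfolding s_def h_def swap_vars_diff by (simp add: algebra_simps)
  then have "swap_vars i ((1 - ?t) * h) = swap_vars i ((1 - ?t * ?a) * s)"
    by simp
  then have 2: "(1 - ?t) * s = (1 - ?t * b) * h"
    by (simp add: swap_vars_mult swap_vars_diff b_def s_def swap_vars_involutive)
  have "(1 - ?t) * ((1 - ?t) * h) = (1 - ?t * ?a) * ((1 - ?t) * s)"
    unfolding 1 by (simp add: algebra_simps)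
  then have 3: "(1 - ?t) * ((1 - ?t) * h) = (1 - ?t * ?a) * ((1 - ?t * b) * h)"
    by (simp only: 2)
  have "?a * ((1 - ?t) * ((1 - ?t) * h)) = (1 - ?t * ?a) * ((?a - ?t * (?a * b)) * h)"
    unfolding 3 by (simp add: algebra_simps)
  then have "?t * (?a - 1) * (?a - 1) * h = 0"
    unfolding ab by (simp add: algebra_simps)
  then show "f = g"
    using tvar_neq_0[where ?'a = 'a] zalpha_neq_1[of i, where ?'a = 'a] by (simp add: h_def)
qed

section \<open>The subring \<open>laurents r\<close>, on which the inverse operator is taken\<close>

lemma laurents_add: "f \<in> laurents r \<Longrightarrow> g \<in> laurents r \<Longrightarrow> f + g \<in> laurents r"
  using keys_add[of f g] unfolding laurents_def by blast

lemma laurents_0: "0 \<in> laurents r"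
  by (simp add: laurents_def)

lemma laurents_1: "1 \<in> laurents r"
  by (simp add: laurents_def)

lemma laurents_uminus: "f \<in> laurents r \<Longrightarrow> - f \<in> laurents r"
  by (simp add: laurents_def in_keys_iff)

lemma laurents_diff: "f \<in> laurents r \<Longrightarrow> g \<in> laurents r \<Longrightarrow> f - g \<in> laurents r"
  using laurents_add[OF _ laurents_uminus, of f r g] by simp

lemma laurents_mult:
  assumes "f \<in> laurents r" "g \<in> laurents r"
  shows "f * g \<in> laurents r"
  unfolding laurents_def
proof (intro CollectI ballI)
  fix m assume "m \<in> Poly_Mapping.keys (f * g)"
  then obtain a b where "m = a + b" "a \<in> Poly_Mapping.keys f" "b \<in> Poly_Mapping.keys g"
    using keys_mult by blast
  then show "Poly_Mapping.keys m \<subseteq> {1..r}"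
    using assms keys_add[of a b] unfolding laurents_def by blast
qed

lemma laurents_power: "f \<in> laurents r \<Longrightarrow> f ^ n \<in> laurents r"
  by (induction n) (simp_all add: laurents_1 laurents_mult)

lemma laurents_sum: "(\<And>x. x \<in> A \<Longrightarrow> f x \<in> laurents r) \<Longrightarrow> (\<Sum>x\<in>A. f x) \<in> laurents r"
  by (induction A rule: infinite_finite_induct) (simp_all add: laurents_0 laurents_add)

lemma laurents_prod: "(\<And>x. x \<in> A \<Longrightarrow> f x \<in> laurents r) \<Longrightarrow> (\<Prod>x\<in>A. f x) \<in> laurents r"
  by (induction A rule: infinite_finite_induct) (simp_all add: laurents_1 laurents_mult)

lemma laurents_tvar: "tvar \<in> laurents r"
  by (simp add: tvar_def laurents_def)

lemma laurents_zvar: "k \<in> {1..r} \<Longrightarrow> zvar k \<in> laurents r"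
  by (simp add: zvar_def laurents_def)

section \<open>The Yang--Baxter equation for monochrome columns\<close>

text \<open>
  With \<open>c = 1\<close>, the first equation says that \<open>Y\<close> is the Demazure--Lusztig operator applied to \<open>X\<close>,
  where primes stand for the exchange of \<open>x\<close> and \<open>y\<close>; the second equation is its image under this
  exchange. The scalar \<open>c\<close>, which is \<open>1\<close> or \<open>t\<close>, is the normalisation of the R-matrix.
\<close>

definition exch :: "'b::idom \<Rightarrow> 'b \<Rightarrow> 'b \<Rightarrow> 'b \<Rightarrow> 'b \<Rightarrow> 'b \<Rightarrow> 'b \<Rightarrow> 'b \<Rightarrow> bool" where
  "exch t x y c X X' Y Y' \<longleftrightarrow>
     c * (x - y) * Y = (1 - t) * y * X - (y - t * x) * X' \<and>
     c * (y - x) * Y' = (1 - t) * x * X' - (x - t * y) * X"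

lemma exch_scale:
  assumes "exch t x y c X X' Y Y'"
  shows "exch t x y c (X * q) (X' * q) (Y * q) (Y' * q)"
  using assms unfolding exch_def by (elim conjE, intro conjI) algebra+

text \<open>A factor t can be traded between the scalar c and either side of the relation. This
  lemma and \<open>exch_scale_right\<close> absorb the extra t that a small color collects when it
  crosses a column at a multiplicity larger by one.\<close>

lemma exch_scale_left:
  assumes "exch t x y 1 X X' Y Y'"
  shows "exch t x y t (t * X) (t * X') Y Y'"
  using assms unfolding exch_def by (elim conjE, intro conjI) algebra+

lemma exch_scale_right:
  assumes "exch t x y t X X' Y Y'"
  shows "exch t x y 1 X X' (t * Y) (t * Y')"
  using assms unfolding exch_def by (simp add: algebra_simps)

lemma exch_add:
  assumes "exch t x y c X X' Y Y'" "exch t x y c U U' V V'"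
  shows "exch t x y c (X + U) (X' + U') (Y + V) (Y' + V')"
  using assms unfolding exch_def by (elim conjE, intro conjI) algebra+

text \<open>The identity (1 - t) y - (y - t x) = t (x - y) singles out the normalisation c =
  t.\<close>

lemma exch_diagonal: "exch t x y t X X X X"
  unfolding exch_def by (simp add: algebra_simps)

lemma exch_0: "exch t x y c 0 0 0 0"
  unfolding exch_def by simp

text \<open>Eliminates X' from the two relations. The coefficient left on X comes from (1 - t)^2 x y
  - (y - t x) (x - t y) = t (x - y)^2, and one factor c (x - y) is then cancelled.\<close>

lemma exch_flip_aux:
  fixes x y :: "'b::idom"
  assumes "c * (x - y) * Y = (1 - t) * y * X - (y - t * x) * X'"
    and "c * (y - x) * Y' = (1 - t) * x * X' - (x - t * y) * X"
    and "x \<noteq> y" "c \<noteq> 0" "c * c' = t"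
  shows "c' * (x - y) * (y * X) = (1 - t) * y * (x * Y) - (y - t * x) * (y * Y')"
proof -
  have "(c * (x - y)) * ((1 - t) * y * (x * Y) - (y - t * x) * (y * Y'))
      = (1 - t) * y * x * (c * (x - y) * Y) + (y - t * x) * y * (c * (y - x) * Y')"
    by (simp add: algebra_simps)
  also have "\<dots> = t * (x - y) * (x - y) * (y * X)"
    unfolding assms(1,2) by (simp add: algebra_simps)
  also have "\<dots> = (c * (x - y)) * (c' * (x - y) * (y * X))"
    using assms(5) by (simp add: algebra_simps flip: assms(5))
  finally show ?thesis using assms(3,4) by simp
qed

text \<open>Inverts the relation: a color that crosses its own column picks up the parameter of its
  row, and the relation between the two entries then holds in the opposite direction with c replaced
  by t / c.\<close>

lemma exch_flip:
  fixes x y :: "'b::idom"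
  assumes "exch t x y c X X' Y Y'" "x \<noteq> y" "c \<noteq> 0" "c * c' = t"
  shows "exch t x y c' (x * Y) (y * Y') (y * X) (x * X')"
  using exch_flip_aux[of c x y Y t X X' Y' c'] exch_flip_aux[of c y x Y' t X' X Y c'] assms
  unfolding exch_def by blast

text \<open>With X and Y the entries at (\<open>Plus\<close>, g) and (g, \<open>Plus\<close>), this
  sum enters both the (\<open>Plus\<close>, \<open>Plus\<close>) and the (g, g) entry behind the
  column of g. Its symmetry keeps the diagonal entries of the two vectors equal.\<close>

lemma exch_symmetric:
  fixes x y :: "'b::idom"
  assumes "exch t x y t X X' Y Y'" "x \<noteq> y" "t \<noteq> 0"
  shows "x * Y + y * X = y * Y' + x * X'"
proof -
  have "t * (x - y) * (x * Y + y * X - (y * Y' + x * X'))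
      = x * (t * (x - y) * Y) + y * (t * (y - x) * Y') + t * (x - y) * (y * X - x * X')"
    by (simp add: algebra_simps)
  also have "\<dots> = 0"
    using assms(1) unfolding exch_def by algebra
  finally show ?thesis using assms(2,3) by simp
qed

text \<open>Here q stands for t^n. The entries are affine in q: the part without q is diagonal, and
  the coefficient of -q is the flipped relation rescaled to c = t.\<close>

lemma exch_own_color:
  fixes x y :: "'b::idom"
  assumes "exch t x y t X X' Y Y'" "x \<noteq> y" "t \<noteq> 0"
  shows "exch t x y t (y * X + x * (1 - t * q) * Y) (x * X' + y * (1 - t * q) * Y')
     (x * Y + y * (1 - q) * X) (y * Y' + x * (1 - q) * X')"
proof -
  have s: "x * Y + y * X = y * Y' + x * X'"
    by (rule exch_symmetric[OF assms])
  have "exch t x y 1 (x * Y) (y * Y') (y * X) (x * X')"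
    by (rule exch_flip[OF assms(1,2,3)]) simp
  then have f: "exch t x y t (t * (x * Y)) (t * (y * Y')) (y * X) (x * X')"
    by (rule exch_scale_left)
  have d: "exch t x y t ((x * Y + y * X)) (y * Y' + x * X') (x * Y + y * X) (y * Y' + x * X')"
    unfolding s by (rule exch_diagonal)
  show ?thesis
    using exch_add[OF d exch_scale[OF f, of "- q"]] by (simp add: algebra_simps)
qed

text \<open>
  The two kinds of weights differ by a gauge: only the products in \<open>down_up_weight\<close> matter for
  the exchange relations.
\<close>

fun down_weight :: "weight_kind \<Rightarrow> nat \<Rightarrow> 'a::idom laurent" where
  "down_weight P_weight n = 1 - tvar ^ (n + 1)"
| "down_weight R_weight n = 1 - tvar"

fun up_weight :: "weight_kind \<Rightarrow> nat \<Rightarrow> 'a::idom laurent" where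
  "up_weight P_weight n = 1"
| "up_weight R_weight n = (\<Sum>k<n + 1. tvar ^ k)"

lemma down_up_weight:
  "down_weight \<kappa> n * up_weight \<kappa> n = (1 - tvar * tvar ^ n :: 'a::idom laurent)"
proof (cases \<kappa>)
  case R_weight
  then show ?thesis
    using one_diff_power_eq[of "tvar :: 'a laurent" "Suc n"] by simp
qed simp

section \<open>The action of one monochrome column on two rows\<close>

lemma mono_weight_eq:
  "mono_weight \<kappa> z g Plus n Plus m = (if m = n then 1 else 0)"
  "mono_weight \<kappa> z g (Col h) n (Col h') m =
     (if h' = h \<and> m = n then (if g < h then 1 else if g = h then z else tvar ^ n) else 0)"
  "mono_weight \<kappa> z g (Col h) n Plus m = (if h = g \<and> m = n + 1 then z * down_weight \<kappa> n else 0)"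
  "mono_weight \<kappa> z g Plus n (Col h) m = (if h = g \<and> n = m + 1 then up_weight \<kappa> m else 0)"
     apply (cases \<kappa>; simp)
    apply (cases \<kappa>; simp)
   apply (cases \<kappa>; simp)
  apply (cases \<kappa>; simp add: exact_div_geometric flip: power_Suc)
  done

definition hspins_of :: "'c set \<Rightarrow> 'c hspin set" where
  "hspins_of C = insert Plus (Col ` C)"

text \<open>A vertex with top spin n has bottom spin at most n + 1, so \<open>n < B\<close> ensures
  that cutting the sum at \<open>B\<close> loses nothing.\<close>

lemma mono_column_sum_top:
  fixes f :: "'c::linorder hspin \<Rightarrow> nat \<Rightarrow> 'a::idom laurent" and z :: "'a laurent" and \<kappa> :: weight_kind
  assumes "finite C" "g \<in> C" "n < B"
  defines "L \<equiv> \<lambda>b. \<Sum>a\<in>hspins_of C. \<Sum>p\<le>B. f a p * mono_weight \<kappa> z g a n b p"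
  shows "L Plus = f Plus n + z * down_weight \<kappa> n * f (Col g) (n + 1)"
    and "h \<in> C \<Longrightarrow> L (Col h) =
      (if h = g then z * f (Col g) n + (if n = 0 then 0 else up_weight \<kappa> (n - 1) * f Plus (n - 1))
       else (if g < h then 1 else tvar ^ n) * f (Col h) n)"
proof -
  have fin: "finite (hspins_of C)" using assms by (simp add: hspins_of_def)
  have restrict: "L b = (\<Sum>a\<in>T. \<Sum>p\<le>B. f a p * mono_weight \<kappa> z g a n b p)"
    if "T \<subseteq> hspins_of C" "\<And>a p. a \<in> hspins_of C - T \<Longrightarrow> mono_weight \<kappa> z g a n b p = 0" for T b
    unfolding L_def using that fin by (intro sum.mono_neutral_right) auto
  have pick: "(\<Sum>p\<le>B. if p = q then F p else 0) = F q" if "q \<le> B" for q and F :: "nat \<Rightarrow> 'a laurent"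
    using that by simp
  have mult_if: "x * (if b then y else 0) = (if b then x * y else 0)" for x y :: "'a laurent" and b
    by simp
  show "L Plus = f Plus n + z * down_weight \<kappa> n * f (Col g) (n + 1)"
    using \<open>n < B\<close> \<open>g \<in> C\<close>
    by (subst restrict[of "{Plus, Col g}"])
       (auto simp: hspins_of_def mono_weight_eq mult_if pick simp del: mono_weight.simps split: if_splits)
  show "L (Col h) =
      (if h = g then z * f (Col g) n + (if n = 0 then 0 else up_weight \<kappa> (n - 1) * f Plus (n - 1))
       else (if g < h then 1 else tvar ^ n) * f (Col h) n)" if "h \<in> C"
  proof (cases "h = g")
    case True
    show ?thesis
      using \<open>n < B\<close> \<open>g \<in> C\<close> True
      by (subst restrict[of "{Plus, Col g}"]; cases n)
         (auto simp: hspins_of_def mono_weight_eq mult_if pick simp del: mono_weight.simps split: if_splits)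
  next
    case False
    then show ?thesis
      using \<open>n < B\<close> that
      by (subst restrict[of "{Col h}"])
         (auto simp: hspins_of_def mono_weight_eq mult_if pick simp del: mono_weight.simps split: if_splits)
  qed
qed

lemma mono_column_sum_bottom:
  fixes f :: "'c::linorder hspin \<Rightarrow> 'a::idom laurent" and z :: "'a laurent" and \<kappa> :: weight_kind and n m :: nat
  assumes "finite C" "g \<in> C"
  defines "L \<equiv> \<lambda>b. \<Sum>a\<in>hspins_of C. f a * mono_weight \<kappa> z g a n b m"
  shows "L Plus = (if m = n then f Plus else 0) +
      (if m = n + 1 then z * down_weight \<kappa> n * f (Col g) else 0)"
    and "h \<in> C \<Longrightarrow> L (Col h) =
      (if h = g then (if m = n then z * f (Col g) else 0) + (if n = m + 1 then up_weight \<kappa> m * f Plus else 0)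
       else if m = n then (if g < h then 1 else tvar ^ n) * f (Col h) else 0)"
proof -
  have fin: "finite (hspins_of C)" using assms by (simp add: hspins_of_def)
  have restrict: "L b = (\<Sum>a\<in>T. f a * mono_weight \<kappa> z g a n b m)"
    if "T \<subseteq> hspins_of C" "\<And>a. a \<in> hspins_of C - T \<Longrightarrow> mono_weight \<kappa> z g a n b m = 0" for T b
    unfolding L_def using that fin by (intro sum.mono_neutral_right) auto
  show "L Plus = (if m = n then f Plus else 0) +
      (if m = n + 1 then z * down_weight \<kappa> n * f (Col g) else 0)"
    using \<open>g \<in> C\<close>
    by (subst restrict[of "{Plus, Col g}"])
       (auto simp: hspins_of_def mono_weight_eq simp del: mono_weight.simps split: if_splits)
  show "L (Col h) =
      (if h = g then (if m = n then z * f (Col g) else 0) + (if n = m + 1 then up_weight \<kappa> m * f Plus else 0)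
       else if m = n then (if g < h then 1 else tvar ^ n) * f (Col h) else 0)" if "h \<in> C"
  proof (cases "h = g")
    case True
    then show ?thesis
      using \<open>g \<in> C\<close>
      by (subst restrict[of "{Plus, Col g}"])
         (auto simp: hspins_of_def mono_weight_eq simp del: mono_weight.simps split: if_splits)
  next
    case False
    then show ?thesis
      using that
      by (subst restrict[of "{Col h}"])
         (auto simp: hspins_of_def mono_weight_eq simp del: mono_weight.simps split: if_splits)
  qed
qed

definition mono_column ::
  "weight_kind \<Rightarrow> 'a::idom laurent \<Rightarrow> 'a laurent \<Rightarrow> 'c::linorder \<Rightarrow> nat \<Rightarrow> nat \<Rightarrow> nat \<Rightarrow>
   'c hspin \<Rightarrow> 'c hspin \<Rightarrow> 'c hspin \<Rightarrow> 'c hspin \<Rightarrow> 'a laurent" where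
  "mono_column \<kappa> x y g n m B a a' b b' =
     (\<Sum>p\<le>B. mono_weight \<kappa> x g a n b p * mono_weight \<kappa> y g a' p b' m)"

definition apply_kernel ::
  "'s set \<Rightarrow> ('s \<Rightarrow> 's \<Rightarrow> 's \<Rightarrow> 's \<Rightarrow> 'b::comm_semiring_1) \<Rightarrow> ('s \<Rightarrow> 's \<Rightarrow> 'b) \<Rightarrow> 's \<Rightarrow> 's \<Rightarrow> 'b" where
  "apply_kernel S K v b b' = (\<Sum>a\<in>S. \<Sum>a'\<in>S. v a a' * K a a' b b')"

definition other_weight :: "'c::linorder \<Rightarrow> 'c \<Rightarrow> nat \<Rightarrow> 'a::idom laurent" where
  "other_weight g h n = (if g < h then 1 else tvar ^ n)"

text \<open>Color conservation sorts the entries by m - n, the number of particles of color g that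
  the two rows leave in the column. For m = n the factors D and U occur only as products D U;
  otherwise they are scalars shared by the entries that get compared, which is why the gauge is
  harmless. The upper row acts first, so \<open>\<phi> h\<close> is taken at n or at m according to
  whether h crosses before or after the multiplicity has changed.\<close>

lemma apply_mono_column:
  fixes v :: "'c::linorder hspin \<Rightarrow> 'c hspin \<Rightarrow> 'a::idom laurent"
    and \<kappa> :: weight_kind and x y :: "'a laurent" and n m :: nat
  assumes C: "finite C" "g \<in> C" and n: "n < B"
  defines "w \<equiv> apply_kernel (hspins_of C) (mono_column \<kappa> x y g n m B) v"
    and "D \<equiv> down_weight \<kappa>" and "U \<equiv> up_weight \<kappa>" and "\<phi> \<equiv> other_weight g"
  shows "w Plus Plus = (if m = n then v Plus Plus else 0)
      + (if m = n + 1 then D n * (x * v (Col g) Plus + y * v Plus (Col g)) else 0)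
      + (if m = n + 2 then x * y * D n * D (n + 1) * v (Col g) (Col g) else 0)"
    and "w (Col g) (Col g) = (if m = n then x * y * v (Col g) (Col g) else 0)
      + (if n = m + 1 then U m * (x * v (Col g) Plus + y * v Plus (Col g)) else 0)
      + (if n = m + 2 then U m * U (m + 1) * v Plus Plus else 0)"
    and "w Plus (Col g) = (if m = n then y * v Plus (Col g) + x * (D m * U m) * v (Col g) Plus else 0)
      + (if n = m + 1 then U m * v Plus Plus else 0)
      + (if m = n + 1 then x * y * D n * v (Col g) (Col g) else 0)"
    and "w (Col g) Plus = (if m = n then x * v (Col g) Plus
          + (if n = 0 then 0 else y * (D (n - 1) * U (n - 1)) * v Plus (Col g)) else 0)
      + (if n = m + 1 then U m * v Plus Plus else 0)
      + (if m = n + 1 then x * y * D n * v (Col g) (Col g) else 0)"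
    and "h \<in> C \<Longrightarrow> k \<in> C \<Longrightarrow> h \<noteq> g \<Longrightarrow> k \<noteq> g \<Longrightarrow>
      w (Col h) (Col k) = (if m = n then \<phi> h n * \<phi> k n * v (Col h) (Col k) else 0)"
    and "h \<in> C \<Longrightarrow> h \<noteq> g \<Longrightarrow> w Plus (Col h) = (if m = n then \<phi> h n * v Plus (Col h) else 0)
      + (if m = n + 1 then x * D n * \<phi> h m * v (Col g) (Col h) else 0)"
    and "h \<in> C \<Longrightarrow> h \<noteq> g \<Longrightarrow> w (Col h) Plus = (if m = n then \<phi> h n * v (Col h) Plus else 0)
      + (if m = n + 1 then y * D n * \<phi> h n * v (Col h) (Col g) else 0)"
    and "h \<in> C \<Longrightarrow> h \<noteq> g \<Longrightarrow> w (Col g) (Col h) = (if m = n then x * \<phi> h n * v (Col g) (Col h) else 0)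
      + (if n = m + 1 then U m * \<phi> h m * v Plus (Col h) else 0)"
    and "h \<in> C \<Longrightarrow> h \<noteq> g \<Longrightarrow> w (Col h) (Col g) = (if m = n then y * \<phi> h n * v (Col h) (Col g) else 0)
      + (if n = m + 1 then U m * \<phi> h n * v (Col h) Plus else 0)"
proof -
  define F where "F b' a p = (\<Sum>a'\<in>hspins_of C. v a a' * mono_weight \<kappa> y g a' p b' m)" for b' a p
  have w: "w b b' = (\<Sum>a\<in>hspins_of C. \<Sum>p\<le>B. F b' a p * mono_weight \<kappa> x g a n b p)" for b b'
  proof -
    have "(\<Sum>a'\<in>hspins_of C. v a a' * mono_column \<kappa> x y g n m B a a' b b')
        = (\<Sum>p\<le>B. F b' a p * mono_weight \<kappa> x g a n b p)" for a
      unfolding mono_column_def F_def sum_distrib_left sum_distrib_right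
      by (subst sum.swap) (intro sum.cong refl, simp only: mult_ac)
    then show ?thesis unfolding w_def apply_kernel_def by simp
  qed
  note top = mono_column_sum_top[OF C n, where f = "F b'" and z = x and \<kappa> = \<kappa> for b', folded w D_def U_def \<phi>_def other_weight_def]
  note bot = mono_column_sum_bottom[OF C, where f = "v a" and \<kappa> = \<kappa> and z = y and n = p and m = m for a p, folded F_def D_def U_def \<phi>_def other_weight_def]
  show "w Plus Plus = (if m = n then v Plus Plus else 0)
      + (if m = n + 1 then D n * (x * v (Col g) Plus + y * v Plus (Col g)) else 0)
      + (if m = n + 2 then x * y * D n * D (n + 1) * v (Col g) (Col g) else 0)"
    by (auto simp: top bot algebra_simps)
  show "w (Col g) (Col g) = (if m = n then x * y * v (Col g) (Col g) else 0)
      + (if n = m + 1 then U m * (x * v (Col g) Plus + y * v Plus (Col g)) else 0)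
      + (if n = m + 2 then U m * U (m + 1) * v Plus Plus else 0)"
    using \<open>g \<in> C\<close> by (cases n) (auto simp: top bot algebra_simps)
  show "w Plus (Col g) = (if m = n then y * v Plus (Col g) + x * (D m * U m) * v (Col g) Plus else 0)
      + (if n = m + 1 then U m * v Plus Plus else 0)
      + (if m = n + 1 then x * y * D n * v (Col g) (Col g) else 0)"
    using \<open>g \<in> C\<close> by (auto simp: top bot algebra_simps)
  show "w (Col g) Plus = (if m = n then x * v (Col g) Plus
          + (if n = 0 then 0 else y * (D (n - 1) * U (n - 1)) * v Plus (Col g)) else 0)
      + (if n = m + 1 then U m * v Plus Plus else 0)
      + (if m = n + 1 then x * y * D n * v (Col g) (Col g) else 0)"
    using \<open>g \<in> C\<close> by (cases n) (auto simp: top bot algebra_simps)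
  show "w (Col h) (Col k) = (if m = n then \<phi> h n * \<phi> k n * v (Col h) (Col k) else 0)"
    if "h \<in> C" "k \<in> C" "h \<noteq> g" "k \<noteq> g"
    using that by (auto simp: top bot other_weight_def \<phi>_def algebra_simps)
  show "w Plus (Col h) = (if m = n then \<phi> h n * v Plus (Col h) else 0)
      + (if m = n + 1 then x * D n * \<phi> h m * v (Col g) (Col h) else 0)" if "h \<in> C" "h \<noteq> g"
    using that by (auto simp: top bot other_weight_def \<phi>_def algebra_simps)
  show "w (Col h) Plus = (if m = n then \<phi> h n * v (Col h) Plus else 0)
      + (if m = n + 1 then y * D n * \<phi> h n * v (Col h) (Col g) else 0)" if "h \<in> C" "h \<noteq> g"
    using that by (auto simp: top bot other_weight_def \<phi>_def algebra_simps)
  show "w (Col g) (Col h) = (if m = n then x * \<phi> h n * v (Col g) (Col h) else 0)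
      + (if n = m + 1 then U m * \<phi> h m * v Plus (Col h) else 0)" if "h \<in> C" "h \<noteq> g"
    using that \<open>g \<in> C\<close> by (cases n) (auto simp: top bot other_weight_def \<phi>_def algebra_simps)
  show "w (Col h) (Col g) = (if m = n then y * \<phi> h n * v (Col h) (Col g) else 0)
      + (if n = m + 1 then U m * \<phi> h n * v (Col h) Plus else 0)" if "h \<in> C" "h \<noteq> g"
    using that \<open>g \<in> C\<close> by (auto simp: top bot other_weight_def \<phi>_def algebra_simps)
qed

text \<open>
  \<open>P\<close> is the set of colors whose monochrome column has already been passed within the current
  colored column. Passing the column of the smallest remaining color moves it to the top of the
  cyclic order of colors, which reverses its relation with the colors not yet passed.
\<close>

definition exch_invariant ::
  "'c::linorder set \<Rightarrow> 'c set \<Rightarrow> 'a::idom laurent \<Rightarrow> 'a laurent \<Rightarrow>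
   ('c hspin \<Rightarrow> 'c hspin \<Rightarrow> 'a laurent) \<Rightarrow> ('c hspin \<Rightarrow> 'c hspin \<Rightarrow> 'a laurent) \<Rightarrow> bool" where
  "exch_invariant C P x y v v' \<longleftrightarrow>
     (\<forall>s\<in>hspins_of C. v s s = v' s s) \<and>
     (\<forall>h\<in>C. exch tvar x y tvar (v Plus (Col h)) (v' Plus (Col h)) (v (Col h) Plus) (v' (Col h) Plus)) \<and>
     (\<forall>h\<in>C. \<forall>k\<in>C. k < h \<longrightarrow>
        (if k \<in> P \<and> h \<notin> P
         then exch tvar x y tvar (v (Col k) (Col h)) (v' (Col k) (Col h)) (v (Col h) (Col k)) (v' (Col h) (Col k))
         else exch tvar x y 1 (v (Col h) (Col k)) (v' (Col h) (Col k)) (v (Col k) (Col h)) (v' (Col k) (Col h))))"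

text \<open>By the assumptions on P, the colors of C below g are exactly those already passed. Two
  other colors only receive a common factor. A pair of g and h is flipped if m = n, and inherits the
  relation of \<open>Plus\<close> and h if a g is picked up (n = m + 1). The pair of
  \<open>Plus\<close> and h inherits from g and h if a g is deposited (m = n + 1).\<close>

lemma exch_invariant_mono_column:
  fixes v v' :: "'c::linorder hspin \<Rightarrow> 'c hspin \<Rightarrow> 'a::idom laurent"
  assumes C: "finite C" "g \<in> C" and n: "n < B" and xy: "x \<noteq> y"
    and P: "\<And>k. k \<in> P \<Longrightarrow> k < g" "\<And>h. h \<in> C - P \<Longrightarrow> g \<le> h"
    and inv: "exch_invariant C P x y v v'"
  shows "exch_invariant C (insert g P) x y
     (apply_kernel (hspins_of C) (mono_column \<kappa> x y g n m B) v)
     (apply_kernel (hspins_of C) (mono_column \<kappa> y x g n m B) v')"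
proof -
  let ?t = "tvar :: 'a laurent"
  define w where "w = apply_kernel (hspins_of C) (mono_column \<kappa> x y g n m B) v"
  define w' where "w' = apply_kernel (hspins_of C) (mono_column \<kappa> y x g n m B) v'"
  note W = apply_mono_column[OF C n, where \<kappa> = \<kappa> and x = x and y = y and m = m and v = v, folded w_def]
    apply_mono_column[OF C n, where \<kappa> = \<kappa> and x = y and y = x and m = m and v = v', folded w'_def]
  have t: "?t \<noteq> 0" by (rule tvar_neq_0)
  have gP: "g \<notin> P" using P(1) by blast
  have diag: "v s s = v' s s" if "s \<in> hspins_of C" for s
    using inv that unfolding exch_invariant_def by blast
  have dP: "v Plus Plus = v' Plus Plus" and dC: "h \<in> C \<Longrightarrow> v (Col h) (Col h) = v' (Col h) (Col h)" for h
    by (auto intro!: diag simp: hspins_of_def)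
  have plus: "exch ?t x y ?t (v Plus (Col h)) (v' Plus (Col h)) (v (Col h) Plus) (v' (Col h) Plus)"
    if "h \<in> C" for h
    using inv that unfolding exch_invariant_def by blast
  have col: "if k \<in> P \<and> h \<notin> P
      then exch ?t x y ?t (v (Col k) (Col h)) (v' (Col k) (Col h)) (v (Col h) (Col k)) (v' (Col h) (Col k))
      else exch ?t x y 1 (v (Col h) (Col k)) (v' (Col h) (Col k)) (v (Col k) (Col h)) (v' (Col k) (Col h))"
    if "h \<in> C" "k \<in> C" "k < h" for h k
    using inv that unfolding exch_invariant_def by blast
  have sym: "x * v (Col g) Plus + y * v Plus (Col g) = y * v' (Col g) Plus + x * v' Plus (Col g)"
    by (rule exch_symmetric[OF plus[OF C(2)] xy t])
  have large: "exch ?t x y 1 (v (Col h) (Col g)) (v' (Col h) (Col g)) (v (Col g) (Col h)) (v' (Col g) (Col h))"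
    if "h \<in> C" "g < h" for h
    using col[OF that(1) C(2) that(2)] gP by simp
  have small: "exch ?t x y ?t (v (Col h) (Col g)) (v' (Col h) (Col g)) (v (Col g) (Col h)) (v' (Col g) (Col h))"
    if "h \<in> C" "h < g" for h
  proof -
    have "h \<in> P" using P(2)[of h] that by (meson DiffI leD)
    then show ?thesis using col[OF C(2) that] gP by simp
  qed
  have large_flip: "exch ?t x y ?t (x * v (Col g) (Col h)) (y * v' (Col g) (Col h))
      (y * v (Col h) (Col g)) (x * v' (Col h) (Col g))" if "h \<in> C" "g < h" for h
    by (rule exch_flip[OF large[OF that] xy]) simp_all
  have small_flip: "exch ?t x y 1 (x * v (Col g) (Col h)) (y * v' (Col g) (Col h))
      (y * v (Col h) (Col g)) (x * v' (Col h) (Col g))" if "h \<in> C" "h < g" for h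
    by (rule exch_flip[OF small[OF that] xy t]) simp_all
  have "w s s = w' s s" if "s \<in> hspins_of C" for s
  proof (cases s)
    case Plus
    then show ?thesis by (simp add: W dP dC[OF C(2)] sym mult_ac)
  next
    case (Col h)
    with that have "h \<in> C" by (auto simp: hspins_of_def)
    then show ?thesis
      by (cases "h = g") (simp_all add: W Col dP dC sym mult_ac)
  qed
  moreover have "exch ?t x y ?t (w Plus (Col h)) (w' Plus (Col h)) (w (Col h) Plus) (w' (Col h) Plus)"
    if h: "h \<in> C" for h
  proof (cases "h = g")
    case True
    consider "m = n" | "n = m + 1" | "m = n + 1" | "m \<noteq> n" "n \<noteq> m + 1" "m \<noteq> n + 1" by blast
    then show ?thesis
    proof cases
      case 1
      \<comment> \<open>An empty edge has nothing to pick up; the formula for positive n covers this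
        because 1 - t^0 = 0.\<close>
      have "(if n = 0 then 0 else q * (down_weight \<kappa> (n - 1) * up_weight \<kappa> (n - 1)) * r)
          = q * (1 - ?t ^ n) * r" for q r
        by (cases n) (simp_all add: down_up_weight)
      then show ?thesis
        using exch_own_color[OF plus[OF C(2)] xy t, of "?t ^ n"]
        unfolding True by (simp add: W 1 down_up_weight)
    next
      case 2
      then show ?thesis unfolding True by (simp add: W dP exch_diagonal)
    next
      case 3
      then show ?thesis
        unfolding True by (simp add: W dC[OF C(2)] exch_diagonal mult.commute[of x y])
    next
      case 4
      then show ?thesis unfolding True by (simp add: W exch_0)
    qed
  next
    case False
    consider "m = n" | "m = n + 1" | "m \<noteq> n" "m \<noteq> n + 1" by blast
    then show ?thesis
    proof cases
      case 1
      then show ?thesis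
        using exch_scale[OF plus[OF h], of "other_weight g h n"] h False
        by (simp add: W mult.commute)
    next
      case 2
      show ?thesis
      proof (cases "g < h")
        case True
        then show ?thesis
          using exch_scale[OF large_flip[OF h True], of "down_weight \<kappa> n"] h
          by (simp add: W 2 other_weight_def mult_ac)
      next
        case nl: False
        with False have "h < g" by simp
        \<comment> \<open>In the (\<open>Plus\<close>, h) entry the lower row crosses after the
          deposit, at multiplicity n + 1, and so has one more t than the (h, \<open>Plus\<close>)
          entry. This raises c from 1 to t.\<close>
        from exch_scale[OF exch_scale_left[OF small_flip[OF h this]], of "?t ^ n * down_weight \<kappa> n"]
        show ?thesis using h False nl
          by (simp add: W 2 other_weight_def mult_ac)
      qed
    next
      case 3
      then show ?thesis using h False by (simp add: W exch_0)
    qed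
  qed
  moreover have "if k \<in> insert g P \<and> h \<notin> insert g P
      then exch ?t x y ?t (w (Col k) (Col h)) (w' (Col k) (Col h)) (w (Col h) (Col k)) (w' (Col h) (Col k))
      else exch ?t x y 1 (w (Col h) (Col k)) (w' (Col h) (Col k)) (w (Col k) (Col h)) (w' (Col k) (Col h))"
    if h: "h \<in> C" and k: "k \<in> C" and kh: "k < h" for h k
  proof -
    consider "h = g" | "k = g" | "h \<noteq> g" "k \<noteq> g" by blast
    then show ?thesis
    proof cases
      case 1
      with kh have neq: "k \<noteq> g" "\<not> g < k" by auto
      consider "m = n" | "n = m + 1" | "m \<noteq> n" "n \<noteq> m + 1" by blast
      then have "exch ?t x y 1 (w (Col g) (Col k)) (w' (Col g) (Col k)) (w (Col k) (Col g)) (w' (Col k) (Col g))"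
      proof cases
        case 1
        then show ?thesis
          using exch_scale[OF small_flip[OF k], of "?t ^ n"] kh \<open>h = g\<close> k neq
          by (simp add: W other_weight_def mult_ac)
      next
        case 2
        \<comment> \<open>Here the (k, g) entry has the extra t, since k crosses in the upper row
          before a g is removed. This lowers c from t to 1.\<close>
        then show ?thesis
          using exch_scale[OF exch_scale_right[OF plus[OF k]], of "?t ^ m * up_weight \<kappa> m"] k neq
          by (simp add: W other_weight_def mult_ac)
      next
        case 3
        then show ?thesis using k neq by (simp add: W exch_0)
      qed
      with 1 show ?thesis by simp
    next
      case 2
      with kh have neq: "h \<noteq> g" "g < h" "h \<notin> P" using P(1) by (auto dest: less_asym)
      consider "m = n" | "n = m + 1" | "m \<noteq> n" "n \<noteq> m + 1" by blast
      then have "exch ?t x y ?t (w (Col g) (Col h)) (w' (Col g) (Col h)) (w (Col h) (Col g)) (w' (Col h) (Col g))"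
      proof cases
        case 1
        then show ?thesis
          using large_flip[OF h neq(2)] h neq by (simp add: W other_weight_def mult_ac)
      next
        case 2
        then show ?thesis
          using exch_scale[OF plus[OF h], of "up_weight \<kappa> m"] h neq
          by (simp add: W other_weight_def mult_ac)
      next
        case 3
        then show ?thesis using h neq by (simp add: W exch_0)
      qed
      with 2 neq show ?thesis by simp
    next
      case 3
      then have P': "k \<in> insert g P \<and> h \<notin> insert g P \<longleftrightarrow> k \<in> P \<and> h \<notin> P" by blast
      show ?thesis
      proof (cases "m = n")
        case True
        let ?q = "other_weight g h n * other_weight g k n :: 'a laurent"
        have w: "w (Col h) (Col k) = v (Col h) (Col k) * ?q" "w (Col k) (Col h) = v (Col k) (Col h) * ?q"
          "w' (Col h) (Col k) = v' (Col h) (Col k) * ?q" "w' (Col k) (Col h) = v' (Col k) (Col h) * ?q"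
          using 3 h k True by (simp_all add: W mult_ac)
        show ?thesis
          unfolding P' w using col[OF h k kh] by (auto intro: exch_scale split: if_splits)
      next
        case False
        then show ?thesis using 3 h k by (simp add: W exch_0)
      qed
    qed
  qed
  ultimately show ?thesis
    unfolding exch_invariant_def w_def[symmetric] w'_def[symmetric] by blast
qed

section \<open>Transfer matrices\<close>

lemma sum_PiE_insert:
  assumes "i \<notin> I"
  shows "(\<Sum>f\<in>PiE (insert i I) T. F f) = (\<Sum>g\<in>PiE I T. \<Sum>y\<in>T i. F (g(i := y)))"
proof -
  have "(\<Sum>f\<in>PiE (insert i I) T. F f) = (\<Sum>(y, g)\<in>T i \<times> PiE I T. F (g(i := y)))"
    unfolding PiE_insert_eq using inj_combinator[OF assms, of T]
    by (subst sum.reindex) (auto simp: case_prod_beta o_def)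
  also have "\<dots> = (\<Sum>y\<in>T i. \<Sum>g\<in>PiE I T. F (g(i := y)))"
    by (rule sum.cartesian_product[symmetric])
  finally show ?thesis by (subst sum.swap)
qed

definition paths :: "nat \<Rightarrow> 's set \<Rightarrow> 's \<Rightarrow> 's \<Rightarrow> (nat \<Rightarrow> 's) set" where
  "paths n S a c = {e \<in> {0..n} \<rightarrow>\<^sub>E S. e n = a \<and> e 0 = c}"

lemma finite_paths: "finite S \<Longrightarrow> finite (paths n S a c)"
  unfolding paths_def by (rule finite_subset[of _ "{0..n} \<rightarrow>\<^sub>E S"]) (auto intro: finite_PiE)

text \<open>The right end is fixed through the codomain and the left end is free, so that this is a
  plain dependent product whose last coordinate \<open>sum_PiE_insert\<close> can split off.\<close>

definition paths_to :: "nat \<Rightarrow> 's set \<Rightarrow> 's \<Rightarrow> (nat \<Rightarrow> 's) set" where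
  "paths_to n S c = PiE {0..n} (\<lambda>k. if k = 0 then {c} else S)"

lemma finite_paths_to: "finite S \<Longrightarrow> finite (paths_to n S c)"
  unfolding paths_to_def by (intro finite_PiE) auto

lemma paths_to_last: "e \<in> paths_to n S c \<Longrightarrow> c \<in> S \<Longrightarrow> e n \<in> S"
  unfolding paths_to_def PiE_def Pi_def by (auto split: if_splits)

lemma paths_eq: "c \<in> S \<Longrightarrow> paths n S a c = {e \<in> paths_to n S c. e n = a}"
  unfolding paths_def paths_to_def PiE_def Pi_def by (auto split: if_splits)

lemma sum_paths:
  assumes "finite S" "c \<in> S"
  shows "(\<Sum>e\<in>paths n S a c. F e) = (\<Sum>e\<in>paths_to n S c. if e n = a then F e else 0)"
  unfolding paths_eq[OF assms(2)]
  by (rule sum.inter_filter) (rule finite_paths_to[OF assms(1)])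

lemma sum_paths_to_Suc:
  "(\<Sum>e\<in>paths_to (Suc n) S c. F e) = (\<Sum>e\<in>paths_to n S c. \<Sum>a\<in>S. F (e(Suc n := a)))"
proof -
  have ins: "{0..Suc n} = insert (Suc n) {0..n}" by auto
  show ?thesis
    unfolding paths_to_def ins by (subst sum_PiE_insert) auto
qed

text \<open>Like the columns of the grid, the kernels \<open>K (n - 1), \<dots>, K 0\<close> are applied in decreasing order.\<close>

fun transfer ::
  "'s set \<Rightarrow> (nat \<Rightarrow> 's \<Rightarrow> 's \<Rightarrow> 's \<Rightarrow> 's \<Rightarrow> 'b::comm_semiring_1) \<Rightarrow> nat \<Rightarrow>
   ('s \<Rightarrow> 's \<Rightarrow> 'b) \<Rightarrow> 's \<Rightarrow> 's \<Rightarrow> 'b"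
where
  "transfer S K 0 v = v"
| "transfer S K (Suc n) v = transfer S K n (apply_kernel S (K n) v)"

lemma transfer_eq_sum_paths:
  assumes "finite S"
  shows "transfer S K n v c c' = (\<Sum>e\<in>paths_to n S c. \<Sum>e'\<in>paths_to n S c'.
     v (e n) (e' n) * (\<Prod>k<n. K k (e (Suc k)) (e' (Suc k)) (e k) (e' k)))"
proof (induction n arbitrary: v)
  case 0
  have "paths_to 0 S s = {(\<lambda>x\<in>{0}. s)}" for s
  proof -
    have "paths_to 0 S s = PiE {0} (\<lambda>_. {s})"
      unfolding paths_to_def atLeastAtMost_singleton by (intro PiE_cong) simp
    then show ?thesis by (simp only: PiE_over_singleton_iff) simp
  qed
  then show ?case by simp
next
  case (Suc n)
  let ?P = "\<lambda>e e'. (\<Prod>k<n. K k (e (Suc k)) (e' (Suc k)) (e k) (e' k))"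
  have upd: "?P (e(Suc n := a)) (e'(Suc n := a')) = ?P e e'" for e e' a a'
    by (intro prod.cong) auto
  have "transfer S K (Suc n) v c c' = (\<Sum>e\<in>paths_to n S c. \<Sum>e'\<in>paths_to n S c'.
      \<Sum>a\<in>S. \<Sum>a'\<in>S. v a a' * K n a a' (e n) (e' n) * ?P e e')"
    by (simp add: Suc.IH apply_kernel_def sum_distrib_right)
  also have "\<dots> = (\<Sum>e\<in>paths_to n S c. \<Sum>a\<in>S. \<Sum>e'\<in>paths_to n S c'.
      \<Sum>a'\<in>S. v a a' * K n a a' (e n) (e' n) * ?P e e')"
    by (intro sum.cong refl sum.swap)
  also have "\<dots> = (\<Sum>e\<in>paths_to (Suc n) S c. \<Sum>e'\<in>paths_to (Suc n) S c'.
      v (e (Suc n)) (e' (Suc n)) * (\<Prod>k<Suc n. K k (e (Suc k)) (e' (Suc k)) (e k) (e' k)))"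
    unfolding sum_paths_to_Suc prod.lessThan_Suc upd
    by (intro sum.cong refl) (simp add: mult_ac)
  finally show ?case .
qed

abbreviation unit_vec :: "'s \<Rightarrow> 's \<Rightarrow> 's \<Rightarrow> 's \<Rightarrow> 'b::comm_semiring_1" where
  "unit_vec a a' \<equiv> \<lambda>s s'. if s = a \<and> s' = a' then 1 else 0"

text \<open>The entries of a colored column are transfers of unit vectors. By linearity the column
  therefore acts on any vector as the composite of its monochrome columns.\<close>

lemma transfer_linear:
  assumes "finite S" "c \<in> S" "c' \<in> S"
  shows "apply_kernel S (\<lambda>a a'. transfer S K n (unit_vec a a')) v c c' = transfer S K n v c c'"
proof -
  let ?P = "\<lambda>e e'. (\<Prod>k<n. K k (e (Suc k)) (e' (Suc k)) (e k) (e' k))"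
  have "apply_kernel S (\<lambda>a a'. transfer S K n (unit_vec a a')) v c c'
      = (\<Sum>a\<in>S. \<Sum>a'\<in>S. \<Sum>e\<in>paths_to n S c. \<Sum>e'\<in>paths_to n S c'.
          v a a' * (unit_vec a a' (e n) (e' n) * ?P e e'))"
    unfolding apply_kernel_def transfer_eq_sum_paths[OF assms(1)] sum_distrib_left ..
  also have "\<dots> = (\<Sum>e\<in>paths_to n S c. \<Sum>e'\<in>paths_to n S c'. \<Sum>a\<in>S. \<Sum>a'\<in>S.
          v a a' * (unit_vec a a' (e n) (e' n) * ?P e e'))"
  proof -
    have "(\<Sum>a\<in>A. \<Sum>a'\<in>A'. \<Sum>e\<in>E. \<Sum>e'\<in>E'. F a a' e e')
        = (\<Sum>e\<in>E. \<Sum>e'\<in>E'. \<Sum>a\<in>A. \<Sum>a'\<in>A'. F a a' e e')"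
      for A A' E E' and F :: "'c \<Rightarrow> 'd \<Rightarrow> 'e \<Rightarrow> 'f \<Rightarrow> 'b"
    proof -
      have "(\<Sum>a\<in>A. \<Sum>a'\<in>A'. \<Sum>e\<in>E. \<Sum>e'\<in>E'. F a a' e e')
          = (\<Sum>a\<in>A. \<Sum>e\<in>E. \<Sum>a'\<in>A'. \<Sum>e'\<in>E'. F a a' e e')"
        by (rule sum.cong[OF refl], rule sum.swap)
      also have "\<dots> = (\<Sum>e\<in>E. \<Sum>a\<in>A. \<Sum>a'\<in>A'. \<Sum>e'\<in>E'. F a a' e e')"
        by (rule sum.swap)
      also have "\<dots> = (\<Sum>e\<in>E. \<Sum>a\<in>A. \<Sum>e'\<in>E'. \<Sum>a'\<in>A'. F a a' e e')"
        by (rule sum.cong[OF refl], rule sum.cong[OF refl], rule sum.swap)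
      also have "\<dots> = (\<Sum>e\<in>E. \<Sum>e'\<in>E'. \<Sum>a\<in>A. \<Sum>a'\<in>A'. F a a' e e')"
        by (rule sum.cong[OF refl], rule sum.swap)
      finally show ?thesis .
    qed
    then show ?thesis .
  qed
  also have "\<dots> = (\<Sum>e\<in>paths_to n S c. \<Sum>e'\<in>paths_to n S c'. v (e n) (e' n) * ?P e e')"
  proof (intro sum.cong refl)
    fix e e' assume "e \<in> paths_to n S c" "e' \<in> paths_to n S c'"
    then have mem: "e n \<in> S" "e' n \<in> S" using assms by (auto dest: paths_to_last)
    have "(\<Sum>a\<in>S. \<Sum>a'\<in>S. v a a' * (unit_vec a a' (e n) (e' n) * ?P e e'))
        = (\<Sum>a\<in>S. if a = e n then (\<Sum>a'\<in>S. if a' = e' n then v a a' * ?P e e' else 0) else 0)"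
      by (intro sum.cong refl) (auto intro!: sum.cong)
    also have "\<dots> = v (e n) (e' n) * ?P e e'"
      using mem assms(1) by simp
    finally show "(\<Sum>a\<in>S. \<Sum>a'\<in>S. v a a' * (unit_vec a a' (e n) (e' n) * ?P e e'))
        = v (e n) (e' n) * ?P e e'" .
  qed
  finally show ?thesis by (simp only: transfer_eq_sum_paths[OF assms(1)])
qed

lemma apply_kernel_cong:
  assumes "\<And>a a'. a \<in> S \<Longrightarrow> a' \<in> S \<Longrightarrow> v a a' = w a a'"
    and "\<And>a a'. a \<in> S \<Longrightarrow> a' \<in> S \<Longrightarrow> K a a' c c' = L a a' c c'"
  shows "apply_kernel S K v c c' = apply_kernel S L w c c'"
  unfolding apply_kernel_def using assms by (intro sum.cong refl) auto

text \<open>For fixed horizontal paths each shared vertical spin occurs in one column only, so the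
  sum over all of them is a product of column sums. Used at two levels: for the monochrome columns
  inside a colored one, and for the colored columns inside a pair of rows.\<close>

lemma two_row_sum_eq_transfer:
  fixes f g :: "nat \<Rightarrow> 'm \<Rightarrow> 's \<Rightarrow> 's \<Rightarrow> 'b::comm_semiring_1"
  assumes S: "finite S" "c \<in> S" "c' \<in> S" and M: "\<And>k. k < n \<Longrightarrow> finite (M k)"
  shows "(\<Sum>m\<in>PiE {..<n} M.
       (\<Sum>e\<in>paths n S a c. \<Prod>k<n. f k (m k) (e (Suc k)) (e k)) *
       (\<Sum>e'\<in>paths n S a' c'. \<Prod>k<n. g k (m k) (e' (Suc k)) (e' k)))
    = transfer S (\<lambda>k p p' q q'. \<Sum>u\<in>M k. f k u p q * g k u p' q') n (unit_vec a a') c c'"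
proof -
  let ?F = "\<lambda>m e. \<Prod>k<n. f k (m k) (e (Suc k)) (e k)"
  let ?G = "\<lambda>m e. \<Prod>k<n. g k (m k) (e (Suc k)) (e k)"
  have "(\<Sum>m\<in>PiE {..<n} M. (\<Sum>e\<in>paths n S a c. ?F m e) * (\<Sum>e'\<in>paths n S a' c'. ?G m e'))
      = (\<Sum>m\<in>PiE {..<n} M. \<Sum>e\<in>paths n S a c. \<Sum>e'\<in>paths n S a' c'. ?F m e * ?G m e')"
    by (simp only: sum_product)
  also have "\<dots> = (\<Sum>e\<in>paths n S a c. \<Sum>m\<in>PiE {..<n} M. \<Sum>e'\<in>paths n S a' c'. ?F m e * ?G m e')"
    by (rule sum.swap)
  also have "\<dots> = (\<Sum>e\<in>paths n S a c. \<Sum>e'\<in>paths n S a' c'. \<Sum>m\<in>PiE {..<n} M. ?F m e * ?G m e')"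
    by (intro sum.cong refl sum.swap)
  also have "\<dots> = (\<Sum>e\<in>paths n S a c. \<Sum>e'\<in>paths n S a' c'.
      \<Prod>k<n. \<Sum>u\<in>M k. f k u (e (Suc k)) (e k) * g k u (e' (Suc k)) (e' k))"
    using M by (subst prod_sum_PiE) (auto simp: prod.distrib)
  also have "\<dots> = transfer S (\<lambda>k p p' q q'. \<Sum>u\<in>M k. f k u p q * g k u p' q') n (unit_vec a a') c c'"
    unfolding transfer_eq_sum_paths[OF S(1)] sum_paths[OF S(1,2)] sum_paths[OF S(1,3)]
    by (intro sum.cong refl) (auto intro!: sum.cong)
  finally show ?thesis .
qed

section \<open>Multisets of bounded multiplicity as tuples of counts\<close>

definition bounded_vspins :: "nat \<Rightarrow> (nat \<Rightarrow> 'c) \<Rightarrow> nat \<Rightarrow> 'c multiset set" where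
  "bounded_vspins r \<gamma> B = {M. set_mset M \<subseteq> \<gamma> ` {1..r} \<and> (\<forall>g. count M g \<le> B)}"

lemma bij_betw_bounded_vspins:
  assumes "inj_on \<gamma> {1..r}"
  shows "bij_betw (\<lambda>M. \<lambda>k\<in>{..<r}. count M (\<gamma> (Suc k))) (bounded_vspins r \<gamma> B)
    (PiE {..<r} (\<lambda>_. {..B}))"
proof (rule bij_betw_byWitness[where f' = "\<lambda>f. \<Sum>k<r. replicate_mset (f k) (\<gamma> (Suc k))"])
  have inj: "\<gamma> (Suc j) = \<gamma> (Suc k) \<longleftrightarrow> j = k" if "j < r" "k < r" for j k
    using inj_onD[OF assms, of "Suc j" "Suc k"] that by auto
  have cnt: "count (\<Sum>k<r. replicate_mset (f k) (\<gamma> (Suc k))) (\<gamma> (Suc j)) = f j" if "j < r" for f j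
  proof -
    have "count (\<Sum>k<r. replicate_mset (f k) (\<gamma> (Suc k))) (\<gamma> (Suc j))
        = (\<Sum>k<r. if k = j then f k else 0)"
      unfolding count_sum by (intro sum.cong refl) (use that inj in auto)
    with that show ?thesis by simp
  qed
  have cnt0: "count (\<Sum>k<r. replicate_mset (f k) (\<gamma> (Suc k))) g = 0" if "g \<notin> \<gamma> ` {1..r}" for f g
    unfolding count_sum using that by (intro sum.neutral) force
  have elim: "\<exists>j<r. g = \<gamma> (Suc j)" if "g \<in> \<gamma> ` {1..r}" for g
  proof -
    obtain j where "j \<in> {1..r}" "g = \<gamma> j" using \<open>g \<in> \<gamma> ` {1..r}\<close> by blast
    then show ?thesis by (intro exI[of _ "j - 1"]) auto
  qed
  show "\<forall>M\<in>bounded_vspins r \<gamma> B.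
      (\<Sum>k<r. replicate_mset ((\<lambda>k\<in>{..<r}. count M (\<gamma> (Suc k))) k) (\<gamma> (Suc k))) = M"
  proof (intro ballI multiset_eqI)
    fix M g assume M: "M \<in> bounded_vspins r \<gamma> B"
    show "count (\<Sum>k<r. replicate_mset ((\<lambda>k\<in>{..<r}. count M (\<gamma> (Suc k))) k) (\<gamma> (Suc k))) g = count M g"
    proof (cases "g \<in> \<gamma> ` {1..r}")
      case True
      then show ?thesis using elim[OF True] by (auto simp: cnt)
    next
      case False
      then have "g \<notin># M" using M by (auto simp: bounded_vspins_def)
      then show ?thesis using cnt0[OF False] by (simp add: not_in_iff)
    qed
  qed
  show "\<forall>f\<in>PiE {..<r} (\<lambda>_. {..B}).
      (\<lambda>k\<in>{..<r}. count (\<Sum>k<r. replicate_mset (f k) (\<gamma> (Suc k))) (\<gamma> (Suc k))) = f"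
  proof
    fix f assume f: "f \<in> PiE {..<r} (\<lambda>_. {..B})"
    have "(\<lambda>k\<in>{..<r}. count (\<Sum>k<r. replicate_mset (f k) (\<gamma> (Suc k))) (\<gamma> (Suc k))) = restrict f {..<r}"
      by (intro restrict_ext cnt) simp
    with f show "(\<lambda>k\<in>{..<r}. count (\<Sum>k<r. replicate_mset (f k) (\<gamma> (Suc k))) (\<gamma> (Suc k))) = f"
      by simp
  qed
  show "(\<lambda>M. \<lambda>k\<in>{..<r}. count M (\<gamma> (Suc k))) ` bounded_vspins r \<gamma> B \<subseteq> PiE {..<r} (\<lambda>_. {..B})"
    by (auto simp: bounded_vspins_def split: if_splits)
  show "(\<lambda>f. \<Sum>k<r. replicate_mset (f k) (\<gamma> (Suc k))) ` PiE {..<r} (\<lambda>_. {..B}) \<subseteq> bounded_vspins r \<gamma> B"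
  proof (intro image_subsetI)
    fix f assume f: "f \<in> PiE {..<r} (\<lambda>_. {..B})"
    let ?M = "\<Sum>k<r. replicate_mset (f k) (\<gamma> (Suc k))"
    have "set_mset ?M \<subseteq> \<gamma> ` {1..r}"
    proof (rule subsetI, rule ccontr)
      fix g assume "g \<in># ?M" "g \<notin> \<gamma> ` {1..r}"
      then show False using cnt0[of g f] not_in_iff by metis
    qed
    moreover have "count ?M g \<le> B" for g
    proof (cases "g \<in> \<gamma> ` {1..r}")
      case True
      from elim[OF True] obtain j where j: "j < r" "g = \<gamma> (Suc j)" by blast
      with f have "f j \<le> B" by (auto dest: PiE_mem)
      with j show ?thesis by (simp only: cnt)
    next
      case False
      then show ?thesis by (simp add: cnt0)
    qed
    ultimately show "?M \<in> bounded_vspins r \<gamma> B" unfolding bounded_vspins_def mem_Collect_eq by blast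
  qed
qed

lemma finite_bounded_vspins: "inj_on \<gamma> {1..r} \<Longrightarrow> finite (bounded_vspins r \<gamma> B)"
  using bij_betw_finite[OF bij_betw_bounded_vspins] by (simp add: finite_PiE)

section \<open>Two adjacent rows\<close>

lemma hspins_eq: "hspins r \<gamma> = hspins_of (\<gamma> ` {1..r})"
  by (simp add: hspins_def hspins_of_def)

lemma finite_hspins: "finite (hspins r \<gamma>)"
  by (simp add: hspins_def)

lemma row_states_eq_paths: "row_states r \<gamma> a c = paths r (hspins r \<gamma>) a c"
  by (simp add: row_states_def paths_def)

lemma prod_atLeast1_atMost: "(\<Prod>k = 1..r. f k) = (\<Prod>k<r. f (Suc k))"
  by (simp add: prod.atLeast1_atMost_eq)

lemma colored_weight_eq:
  "colored_weight \<kappa> r \<gamma> z a B c D = (\<Sum>e\<in>paths r (hspins r \<gamma>) a c.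
     \<Prod>k<r. mono_weight \<kappa> z (\<gamma> (Suc k)) (e (Suc k)) (count B (\<gamma> (Suc k))) (e k) (count D (\<gamma> (Suc k))))"
  unfolding colored_weight_def row_states_eq_paths prod_atLeast1_atMost by simp

lemma exch_invariant_cong:
  assumes "\<And>s s'. s \<in> hspins_of C \<Longrightarrow> s' \<in> hspins_of C \<Longrightarrow> v s s' = w s s'"
    and "\<And>s s'. s \<in> hspins_of C \<Longrightarrow> s' \<in> hspins_of C \<Longrightarrow> v' s s' = w' s s'"
    and "exch_invariant C P x y v v'"
  shows "exch_invariant C P x y w w'"
proof -
  have mem: "Plus \<in> hspins_of C" "\<And>h. h \<in> C \<Longrightarrow> Col h \<in> hspins_of C"
    by (auto simp: hspins_of_def)
  show ?thesis
    using assms(3) unfolding exch_invariant_def by (simp add: assms(1,2) mem cong: if_cong)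
qed

lemma exch_invariant_unpassedD:
  assumes "exch_invariant C {} x y v v'" "h \<in> C" "k \<in> C" "k < h"
  shows "exch tvar x y 1 (v (Col h) (Col k)) (v' (Col h) (Col k)) (v (Col k) (Col h)) (v' (Col k) (Col h))"
  using assms unfolding exch_invariant_def by auto

text \<open>After a full rotation the cyclic order of the colors is the original one; this lets the
  invariant continue from one colored column to the next.\<close>

lemma exch_invariant_all_passed: "exch_invariant C C x y v v' \<longleftrightarrow> exch_invariant C {} x y v v'"
  unfolding exch_invariant_def by simp

text \<open>Here n counts the monochrome columns still ahead. They are met in increasing order of
  color, so the ones behind have the colors \<open>\<gamma> k\<close> with k > n.\<close>

lemma exch_invariant_transfer_mono:
  fixes v v' :: "'c::linorder hspin \<Rightarrow> 'c hspin \<Rightarrow> 'a::idom laurent"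
  assumes anti: "strict_antimono_on {1..r} \<gamma>" and xy: "x \<noteq> y" and n: "n \<le> r"
    and bound: "\<And>k. p k < B"
    and inv: "exch_invariant (\<gamma> ` {1..r}) (\<gamma> ` {n<..r}) x y v v'"
  shows "exch_invariant (\<gamma> ` {1..r}) (\<gamma> ` {1..r}) x y
    (transfer (hspins r \<gamma>) (\<lambda>k. mono_column \<kappa> x y (\<gamma> (Suc k)) (p k) (q k) B) n v)
    (transfer (hspins r \<gamma>) (\<lambda>k. mono_column \<kappa> y x (\<gamma> (Suc k)) (p k) (q k) B) n v')"
  using n inv
proof (induction n arbitrary: v v')
  case 0
  have "{0<..r} = {1..r}" by auto
  with 0 show ?case by simp
next
  case (Suc n)
  have less: "\<gamma> j < \<gamma> i" if "i \<in> {1..r}" "j \<in> {1..r}" "i < j" for i j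
    using anti that by (auto simp: monotone_on_def)
  have ins: "insert (\<gamma> (Suc n)) (\<gamma> ` {Suc n<..r}) = \<gamma> ` {n<..r}"
  proof -
    have "{n<..r} = insert (Suc n) {Suc n<..r}" using Suc.prems by auto
    then show ?thesis by simp
  qed
  have "exch_invariant (\<gamma> ` {1..r}) (insert (\<gamma> (Suc n)) (\<gamma> ` {Suc n<..r})) x y
     (apply_kernel (hspins_of (\<gamma> ` {1..r})) (mono_column \<kappa> x y (\<gamma> (Suc n)) (p n) (q n) B) v)
     (apply_kernel (hspins_of (\<gamma> ` {1..r})) (mono_column \<kappa> y x (\<gamma> (Suc n)) (p n) (q n) B) v')"
  proof (rule exch_invariant_mono_column[OF _ _ bound xy])
    show "k < \<gamma> (Suc n)" if "k \<in> \<gamma> ` {Suc n<..r}" for k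
      using that less[of "Suc n"] by auto
    show "\<gamma> (Suc n) \<le> h" if h: "h \<in> \<gamma> ` {1..r} - \<gamma> ` {Suc n<..r}" for h
    proof -
      obtain j where j: "j \<in> {1..r}" "h = \<gamma> j" "j \<notin> {Suc n<..r}"
        using h by blast
      then have "j < Suc n \<or> j = Suc n" by auto
      then show ?thesis
        using less[of j "Suc n"] j Suc.prems(1) by (auto intro: less_imp_le)
    qed
    show "exch_invariant (\<gamma> ` {1..r}) (\<gamma> ` {Suc n<..r}) x y v v'" by (rule Suc.prems)
  qed (use Suc.prems in auto)
  then show ?case
    unfolding transfer.simps hspins_eq[symmetric] ins
    using Suc.prems by (intro Suc.IH) auto
qed

definition colored_column ::
  "weight_kind \<Rightarrow> nat \<Rightarrow> (nat \<Rightarrow> 'c::linorder) \<Rightarrow> 'a::idom laurent \<Rightarrow> 'a laurent \<Rightarrow> nat \<Rightarrow>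
   'c multiset \<Rightarrow> 'c multiset \<Rightarrow> 'c hspin \<Rightarrow> 'c hspin \<Rightarrow> 'c hspin \<Rightarrow> 'c hspin \<Rightarrow> 'a laurent" where
  "colored_column \<kappa> r \<gamma> x y B A D a a' b b' =
     (\<Sum>M\<in>bounded_vspins r \<gamma> B. colored_weight \<kappa> r \<gamma> x a A b M * colored_weight \<kappa> r \<gamma> y a' M b' D)"

lemma colored_column_eq_transfer:
  assumes inj: "inj_on \<gamma> {1..r}" and b: "b \<in> hspins r \<gamma>" "b' \<in> hspins r \<gamma>"
  shows "colored_column \<kappa> r \<gamma> x y B A D a a' b b' =
    transfer (hspins r \<gamma>)
      (\<lambda>k. mono_column \<kappa> x y (\<gamma> (Suc k)) (count A (\<gamma> (Suc k))) (count D (\<gamma> (Suc k))) B)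
      r (unit_vec a a') b b'"
proof -
  let ?f = "\<lambda>k u s s'. mono_weight \<kappa> x (\<gamma> (Suc k)) s (count A (\<gamma> (Suc k))) s' u"
  let ?g = "\<lambda>k u s s'. mono_weight \<kappa> y (\<gamma> (Suc k)) s u s' (count D (\<gamma> (Suc k)))"
  let ?S = "hspins r \<gamma>"
  have "colored_column \<kappa> r \<gamma> x y B A D a a' b b' = (\<Sum>M\<in>bounded_vspins r \<gamma> B.
       (\<Sum>e\<in>paths r ?S a b. \<Prod>k<r. ?f k ((\<lambda>k\<in>{..<r}. count M (\<gamma> (Suc k))) k) (e (Suc k)) (e k)) *
       (\<Sum>e\<in>paths r ?S a' b'. \<Prod>k<r. ?g k ((\<lambda>k\<in>{..<r}. count M (\<gamma> (Suc k))) k) (e (Suc k)) (e k)))"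
    unfolding colored_column_def colored_weight_eq by simp
  also have "\<dots> = (\<Sum>m\<in>PiE {..<r} (\<lambda>_. {..B}).
       (\<Sum>e\<in>paths r ?S a b. \<Prod>k<r. ?f k (m k) (e (Suc k)) (e k)) *
       (\<Sum>e\<in>paths r ?S a' b'. \<Prod>k<r. ?g k (m k) (e (Suc k)) (e k)))"
    by (rule sum.reindex_bij_betw[OF bij_betw_bounded_vspins[OF inj],
          where g = "\<lambda>m. (\<Sum>e\<in>paths r ?S a b. \<Prod>k<r. ?f k (m k) (e (Suc k)) (e k)) *
            (\<Sum>e\<in>paths r ?S a' b'. \<Prod>k<r. ?g k (m k) (e (Suc k)) (e k))"])
  also have "\<dots> = transfer ?S (\<lambda>k p p' q q'. \<Sum>u\<le>B. ?f k u p q * ?g k u p' q') r (unit_vec a a') b b'"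
    by (rule two_row_sum_eq_transfer[OF finite_hspins b]) simp
  finally show ?thesis unfolding mono_column_def .
qed

lemma exch_invariant_colored_column:
  fixes v v' :: "'c::linorder hspin \<Rightarrow> 'c hspin \<Rightarrow> 'a::idom laurent"
  assumes anti: "strict_antimono_on {1..r} \<gamma>" and inj: "inj_on \<gamma> {1..r}" and xy: "x \<noteq> y"
    and bound: "\<And>g. count A g < B"
    and inv: "exch_invariant (\<gamma> ` {1..r}) {} x y v v'"
  shows "exch_invariant (\<gamma> ` {1..r}) {} x y
    (apply_kernel (hspins r \<gamma>) (colored_column \<kappa> r \<gamma> x y B A D) v)
    (apply_kernel (hspins r \<gamma>) (colored_column \<kappa> r \<gamma> y x B A D) v')"
proof -
  let ?S = "hspins r \<gamma>"
  let ?K = "\<lambda>x y k. mono_column \<kappa> x y (\<gamma> (Suc k)) (count A (\<gamma> (Suc k))) (count D (\<gamma> (Suc k))) B"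
  have eq: "apply_kernel ?S (colored_column \<kappa> r \<gamma> x y B A D) v s s' = transfer ?S (?K x y) r v s s'"
    if "s \<in> ?S" "s' \<in> ?S" for s s' x y and v :: "'c hspin \<Rightarrow> 'c hspin \<Rightarrow> 'a laurent"
  proof -
    have "apply_kernel ?S (colored_column \<kappa> r \<gamma> x y B A D) v s s'
        = apply_kernel ?S (\<lambda>a a'. transfer ?S (?K x y) r (unit_vec a a')) v s s'"
      by (rule apply_kernel_cong) (simp_all add: colored_column_eq_transfer[OF inj that])
    also have "\<dots> = transfer ?S (?K x y) r v s s'"
      by (rule transfer_linear[OF finite_hspins that])
    finally show ?thesis .
  qed
  have "exch_invariant (\<gamma> ` {1..r}) (\<gamma> ` {1..r}) x y (transfer ?S (?K x y) r v) (transfer ?S (?K y x) r v')"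
  proof (rule exch_invariant_transfer_mono[OF anti xy order_refl bound])
    have e: "\<gamma> ` {r<..r} = {}" by simp
    show "exch_invariant (\<gamma> ` {1..r}) (\<gamma> ` {r<..r}) x y v v'"
      unfolding e by (rule inv)
  qed
  then have "exch_invariant (\<gamma> ` {1..r}) {} x y (transfer ?S (?K x y) r v) (transfer ?S (?K y x) r v')"
    by (simp only: exch_invariant_all_passed)
  then show ?thesis
    by (rule exch_invariant_cong[rotated 2]) (simp_all only: eq hspins_eq[symmetric])
qed

definition row_weight ::
  "weight_kind \<Rightarrow> nat \<Rightarrow> (nat \<Rightarrow> 'c::linorder) \<Rightarrow> nat \<Rightarrow> 'a::idom laurent \<Rightarrow> 'c \<Rightarrow>
   (nat \<Rightarrow> 'c multiset) \<Rightarrow> (nat \<Rightarrow> 'c multiset) \<Rightarrow> 'a laurent" where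
  "row_weight \<kappa> r \<gamma> n z s A D = (\<Sum>e\<in>paths n (hspins r \<gamma>) Plus (Col s).
     \<Prod>j<n. colored_weight \<kappa> r \<gamma> z (e (Suc j)) (A j) (e j) (D j))"

definition two_row_weight ::
  "weight_kind \<Rightarrow> nat \<Rightarrow> (nat \<Rightarrow> 'c::linorder) \<Rightarrow> nat \<Rightarrow> nat \<Rightarrow> 'a::idom laurent \<Rightarrow> 'a laurent \<Rightarrow>
   (nat \<Rightarrow> 'c multiset) \<Rightarrow> (nat \<Rightarrow> 'c multiset) \<Rightarrow> 'c \<Rightarrow> 'c \<Rightarrow> 'a laurent" where
  "two_row_weight \<kappa> r \<gamma> n B x y A D s s' =
     (\<Sum>M\<in>{..<n} \<rightarrow>\<^sub>E bounded_vspins r \<gamma> B. row_weight \<kappa> r \<gamma> n x s A M * row_weight \<kappa> r \<gamma> n y s' M D)"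

lemma two_row_weight_exch:
  fixes x y :: "'a::idom laurent" and \<kappa> :: weight_kind
  assumes anti: "strict_antimono_on {1..r} \<gamma>" and inj: "inj_on \<gamma> {1..r}" and xy: "x \<noteq> y"
    and bound: "\<And>j g. j < n \<Longrightarrow> count (A j) g < B"
    and hk: "h \<in> \<gamma> ` {1..r}" "k \<in> \<gamma> ` {1..r}" "k < h"
  defines "T \<equiv> two_row_weight \<kappa> r \<gamma> n B"
  shows "exch tvar x y 1 (T x y A D h k) (T y x A D h k) (T x y A D k h) (T y x A D k h)"
proof -
  let ?S = "hspins r \<gamma>"
  let ?K = "\<lambda>x y j. colored_column \<kappa> r \<gamma> x y B (A j) (D j)"
  have T: "T x y A D s s' = transfer ?S (?K x y) n (unit_vec Plus Plus) (Col s) (Col s')"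
    if "s \<in> \<gamma> ` {1..r}" "s' \<in> \<gamma> ` {1..r}" for s s' and x y :: "'a laurent"
    unfolding T_def two_row_weight_def row_weight_def colored_column_def
    using that by (intro two_row_sum_eq_transfer finite_hspins finite_bounded_vspins inj)
      (auto simp: hspins_def)
  have "exch_invariant (\<gamma> ` {1..r}) {} x y (transfer ?S (?K x y) m v) (transfer ?S (?K y x) m v')"
    if "m \<le> n" "exch_invariant (\<gamma> ` {1..r}) {} x y v v'" for m v v'
    using that
  proof (induction m arbitrary: v v')
    case (Suc m)
    then show ?case
      unfolding transfer.simps
      by (intro Suc.IH exch_invariant_colored_column[OF anti inj xy bound]) auto
  qed simp
  \<comment> \<open>All left edges are \<open>Plus\<close>, so both orders of the parameters start
    from the same unit vector.\<close>
  from this[OF order_refl, of "unit_vec Plus Plus" "unit_vec Plus Plus"]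
  have "exch_invariant (\<gamma> ` {1..r}) {} x y
      (transfer ?S (?K x y) n (unit_vec Plus Plus)) (transfer ?S (?K y x) n (unit_vec Plus Plus))"
    by (simp add: exch_invariant_def exch_0)
  then show ?thesis
    unfolding T[OF hk(1,2)] T[OF hk(2,1)] by (rule exch_invariant_unpassedD[OF _ hk])
qed

section \<open>Lengths and the exchange condition\<close>

definition word_prod :: "nat list \<Rightarrow> nat \<Rightarrow> nat" where
  "word_prod is = foldr (\<lambda>i u. simple_refl i \<circ> u) is id"

lemma word_prod_Nil: "word_prod [] = id"
  by (simp add: word_prod_def)

lemma word_prod_Cons: "word_prod (i # is) = simple_refl i \<circ> word_prod is"
  by (simp add: word_prod_def)

lemma bij_word_prod: "bij (word_prod is)"
  by (induction "is") (simp_all only: word_prod_Nil word_prod_Cons bij_id bij_comp bij_transpose)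

text \<open>Induction on the word. If the reflection is the first letter, that letter is deleted.
  Otherwise it is conjugated past the first letter s_j, which keeps a < b because s_j reverses the
  order of the pair j, j + 1 alone.\<close>

lemma exchange_condition:
  assumes "u = word_prod is" "set is \<subseteq> J"
    and "a < b" "inv u b < inv u a"
  shows "\<exists>js. length js < length is \<and> set js \<subseteq> J \<and>
    transpose a b \<circ> u = word_prod js"
  using assms
proof (induction "is" arbitrary: u a b)
  case Nil
  then show ?case by (simp add: word_prod_Nil)
next
  case (Cons j "is")
  define u' where "u' = word_prod is"
  have u: "u = simple_refl j \<circ> u'"
    using Cons.prems(1) by (simp only: u'_def word_prod_Cons)
  show ?case
  proof (cases "a = j \<and> b = j + 1")
    case True
    then have "transpose a b \<circ> u = u'"
      unfolding u by (simp add: fun_eq_iff)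
    with Cons.prems(2) show ?thesis
      unfolding u'_def by (intro exI[of _ "is"]) simp
  next
    case False
    let ?s = "simple_refl j"
    have inv_u: "inv u x = inv u' (?s x)" for x
      unfolding u using bij_word_prod[of "is"] by (simp add: o_inv_distrib u'_def[symmetric])
    have less: "?s a < ?s b"
      using False \<open>a < b\<close> by (auto simp: transpose_def)
    have "inv u' (?s b) < inv u' (?s a)"
      using Cons.prems(4) by (simp only: inv_u)
    moreover have "set is \<subseteq> J"
      using Cons.prems(2) by simp
    ultimately
    obtain js where js: "length js < length is" "set js \<subseteq> J"
      "transpose (?s a) (?s b) \<circ> u' = word_prod js"
      using Cons.IH[OF u'_def _ less] by blast
    have "transpose a b \<circ> u = ?s \<circ> (transpose (?s a) (?s b) \<circ> u')"
      unfolding u using transpose_comp_eq[OF bij_transpose, of a b j "j + 1"]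
      by (simp only: inv_transpose_eq o_assoc)
    with js Cons.prems(2) show ?thesis
      by (intro exI[of _ "j # js"]) (simp add: word_prod_Cons)
  qed
qed

text \<open>Contrapositive: at an inversion the exchange condition shortens a minimal word of
  u.\<close>

lemma cox_length_less_imp:
  assumes i: "i \<in> {1..<r}"
    and less: "cox_length r u < cox_length r (simple_refl i \<circ> u)"
  shows "inv u i \<le> inv u (i + 1)"
proof (rule ccontr)
  assume "\<not> ?thesis"
  then have gt: "inv u (i + 1) < inv u i" by simp
  have cl: "cox_length r v = (LEAST n. \<exists>is. length is = n \<and> set is \<subseteq> {1..<r} \<and> v = word_prod is)"
    for v unfolding cox_length_def word_prod_def ..
  let ?word = "\<lambda>v is. set is \<subseteq> {1..<r} \<and> v = word_prod is"
  have invol: "simple_refl i \<circ> (simple_refl i \<circ> u) = u"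
    by (simp add: fun_eq_iff)
  show False
  proof (cases "\<exists>is. ?word u is")
    case True
    then have "\<exists>n is. length is = n \<and> ?word u is" by blast
    from LeastI_ex[OF this] obtain "is" where
      "is": "length is = cox_length r u" "?word u is"
      unfolding cl by blast
    from exchange_condition[of u "is" "{1..<r}" i "i + 1"] "is" gt
    obtain js where "length js < length is" "?word (simple_refl i \<circ> u) js"
      by auto
    moreover from this have "cox_length r (simple_refl i \<circ> u) \<le> length js"
      unfolding cl by (intro Least_le) blast
    ultimately show False using less "is" by simp
  next
    \<comment> \<open>If u has no word, neither has s_i u. Both lengths are then the same
      \<open>LEAST\<close> of an empty predicate, so that generation of the symmetric group by
      simple reflections does not have to be proved.\<close>
    case False
    then have none: "\<not> ?word u is" for "is" by blast
    have "\<not> ?word (simple_refl i \<circ> u) is" for "is"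
    proof
      assume "?word (simple_refl i \<circ> u) is"
      then have "?word u (i # is)"
        using i invol by (auto simp only: word_prod_Cons list.set)
      with none show False by blast
    qed
    with none have "cox_length r u = cox_length r (simple_refl i \<circ> u)"
      unfolding cl by (simp only: simp_thms)
    with less show False by simp
  qed
qed

lemma bruhat_less_cox_length: "bruhat_less r u v \<Longrightarrow> cox_length r u < cox_length r v"
  unfolding bruhat_less_def
  by (induction rule: tranclp_induct) (auto simp: bruhat_step_def)

section \<open>The partition function as a sum over rows\<close>

lemma sum_PiE_Times:
  "(\<Sum>f\<in>PiE (I \<times> J) (\<lambda>p. T (fst p) (snd p)). F f)
    = (\<Sum>g\<in>PiE I (\<lambda>i. PiE J (T i)). F (\<lambda>p\<in>I \<times> J. g (fst p) (snd p)))"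
proof (rule sum.reindex_bij_witness[where
      i = "\<lambda>g. \<lambda>p\<in>I \<times> J. g (fst p) (snd p)" and j = "\<lambda>f. \<lambda>i\<in>I. \<lambda>j\<in>J. f (i, j)"])
  fix f assume f: "f \<in> PiE (I \<times> J) (\<lambda>p. T (fst p) (snd p))"
  show eq: "(\<lambda>p\<in>I \<times> J. (\<lambda>i\<in>I. \<lambda>j\<in>J. f (i, j)) (fst p) (snd p)) = f"
  proof
    fix p
    show "(\<lambda>p\<in>I \<times> J. (\<lambda>i\<in>I. \<lambda>j\<in>J. f (i, j)) (fst p) (snd p)) p = f p"
      using PiE_arb[OF f, of p] by (cases "p \<in> I \<times> J") auto
  qed
  show "F (\<lambda>p\<in>I \<times> J. (\<lambda>i\<in>I. \<lambda>j\<in>J. f (i, j)) (fst p) (snd p)) = F f"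
    by (simp only: eq)
  have "f (i, j) \<in> T i j" if "i \<in> I" "j \<in> J" for i j
    using PiE_mem[OF f, of "(i, j)"] that by simp
  then show "(\<lambda>i\<in>I. \<lambda>j\<in>J. f (i, j)) \<in> PiE I (\<lambda>i. PiE J (T i))"
    by (intro restrict_PiE_iff[THEN iffD2] ballI) simp
next
  fix g assume g: "g \<in> PiE I (\<lambda>i. PiE J (T i))"
  show "(\<lambda>i\<in>I. \<lambda>j\<in>J. (\<lambda>p\<in>I \<times> J. g (fst p) (snd p)) (i, j)) = g"
  proof
    fix i
    show "(\<lambda>i\<in>I. \<lambda>j\<in>J. (\<lambda>p\<in>I \<times> J. g (fst p) (snd p)) (i, j)) i = g i"
    proof (cases "i \<in> I")
      case True
      show ?thesis
      proof
        fix j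
        show "(\<lambda>i\<in>I. \<lambda>j\<in>J. (\<lambda>p\<in>I \<times> J. g (fst p) (snd p)) (i, j)) i j = g i j"
          using PiE_arb[OF PiE_mem[OF g True], of j] True by (cases "j \<in> J") auto
      qed
    next
      case False
      then show ?thesis using PiE_arb[OF g False] by simp
    qed
  qed
  have "g i j \<in> T i j" if "i \<in> I" "j \<in> J" for i j
    using PiE_mem[OF PiE_mem[OF g that(1)] that(2)] .
  then show "(\<lambda>p\<in>I \<times> J. g (fst p) (snd p)) \<in> PiE (I \<times> J) (\<lambda>p. T (fst p) (snd p))"
    by (intro restrict_PiE_iff[THEN iffD2] ballI) auto
qed

lemma mono_weight_nonzero: "mono_weight \<kappa> z g a n b m \<noteq> 0 \<Longrightarrow> m \<le> n + 1"
  by (cases a; cases b) (auto simp del: mono_weight.simps simp: mono_weight_eq split: if_splits)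

lemma colored_weight_nonzero:
  assumes "colored_weight \<kappa> r \<gamma> z a A b D \<noteq> 0" "k \<in> {1..r}"
  shows "count D (\<gamma> k) \<le> count A (\<gamma> k) + 1"
proof -
  obtain e where
    "(\<Prod>k = 1..r. mono_weight \<kappa> z (\<gamma> k) (e k) (count A (\<gamma> k)) (e (k - 1)) (count D (\<gamma> k))) \<noteq> 0"
    using assms(1) unfolding colored_weight_def
    by (meson sum.not_neutral_contains_not_neutral)
  then have "mono_weight \<kappa> z (\<gamma> k) (e k) (count A (\<gamma> k)) (e (k - 1)) (count D (\<gamma> k)) \<noteq> 0"
    using assms(2) by (auto simp del: mono_weight.simps)
  then show ?thesis by (rule mono_weight_nonzero)
qed

lemma count_top_spin_le: "count (top_spin r lam c j) g \<le> r"
proof -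
  have "count (top_spin r lam c j) g \<le> size (top_spin r lam c j)"
    by (rule count_le_size)
  also have "\<dots> = card {i \<in> {1..r}. lam i = j}"
    by (simp add: top_spin_def)
  also have "\<dots> \<le> card {1..r}"
    by (intro card_mono) auto
  finally show ?thesis by simp
qed

lemma state_multiplicity_bound:
  assumes st: "(H, V) \<in> states r \<gamma> N lam c d" and nz: "state_weight \<kappa> r \<gamma> N (H, V) \<noteq> (0 :: 'a::idom laurent)"
    and "i \<le> r" "j \<le> N"
  shows "count (V (i, j)) g \<le> r + i"
  using \<open>i \<le> r\<close>
proof (induction i)
  case 0
  then show ?case
    using st \<open>j \<le> N\<close> by (simp add: states_def count_top_spin_le)
next
  case (Suc i)
  have "V (Suc i, j) \<in> vspins r \<gamma>"
    using st Suc.prems \<open>j \<le> N\<close> unfolding states_def by (auto dest: PiE_mem)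
  then have supp: "set_mset (V (Suc i, j)) \<subseteq> \<gamma> ` {1..r}"
    by (simp add: vspins_def)
  show ?case
  proof (cases "g \<in> \<gamma> ` {1..r}")
    case True
    then obtain k where k: "k \<in> {1..r}" "g = \<gamma> k" by blast
    have "colored_weight \<kappa> r \<gamma> (zvar (Suc i) :: 'a laurent)
        (H (Suc i, j + 1)) (V (Suc i - 1, j)) (H (Suc i, j)) (V (Suc i, j)) \<noteq> 0"
    proof
      assume "colored_weight \<kappa> r \<gamma> (zvar (Suc i) :: 'a laurent)
        (H (Suc i, j + 1)) (V (Suc i - 1, j)) (H (Suc i, j)) (V (Suc i, j)) = 0"
      then have "state_weight \<kappa> r \<gamma> N (H, V) = (0 :: 'a laurent)"
        unfolding state_weight_def case_prod_conv using Suc.prems \<open>j \<le> N\<close>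
        by (intro prod_zero finite_atLeastAtMost bexI[of _ "Suc i"] bexI[of _ j]) auto
      with nz show False by simp
    qed
    from colored_weight_nonzero[OF this k(1)] Suc show ?thesis
      by (simp add: k(2))
  next
    case False
    then have "count (V (Suc i, j)) g = 0"
      using supp not_in_iff by (metis subsetD)
    then show ?thesis by simp
  qed
qed

text \<open>
  By color conservation a multiplicity grows by at most one per row, so the bound \<open>r + i\<close> in row \<open>i\<close>
  loses no state of nonzero weight. It depends on \<open>i\<close> so that the sum over row \<open>i\<close> with row \<open>i - 1\<close>
  fixed is never truncated.
\<close>

definition bounded_row ::
  "nat \<Rightarrow> (nat \<Rightarrow> 'c) \<Rightarrow> nat \<Rightarrow> (nat \<Rightarrow> nat) \<Rightarrow> (nat \<Rightarrow> 'c) \<Rightarrow> nat \<Rightarrow> (nat \<Rightarrow> 'c multiset) set" where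
  "bounded_row r \<gamma> N lam c i = PiE {0..N} (\<lambda>j. {M \<in> bounded_vspins r \<gamma> (r + i).
     (i = 0 \<longrightarrow> M = top_spin r lam c j) \<and> (i = r \<longrightarrow> M = {#})})"

lemma bounded_vspins_subset: "bounded_vspins r \<gamma> B \<subseteq> vspins r \<gamma>"
  by (auto simp: bounded_vspins_def vspins_def)

lemma atLeast0AtMost_eq: "{0..N} = {..<Suc N}"
  by auto

lemma row_weight_cong:
  assumes "\<And>j. j < n \<Longrightarrow> A j = A' j" "\<And>j. j < n \<Longrightarrow> D j = D' j"
  shows "row_weight \<kappa> r \<gamma> n z s A D = row_weight \<kappa> r \<gamma> n z s A' D'"
  unfolding row_weight_def using assms by (intro sum.cong prod.cong refl) auto

text \<open>\<open>HB\<close> and \<open>VB\<close> build the boundary conditions into finite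
  dependent products. This box lies inside the states and contains all states of nonzero weight.
  Once V is fixed, the sum over H factors into rows.\<close>

lemma partition_function_eq_sum_rows:
  fixes \<kappa> :: weight_kind
  assumes inj: "inj_on \<gamma> {1..r}"
  shows "(partition_function \<kappa> r \<gamma> N lam c d :: 'a::idom laurent) =
    (\<Sum>G\<in>PiE {0..r} (bounded_row r \<gamma> N lam c).
       \<Prod>k = 1..r. row_weight \<kappa> r \<gamma> (Suc N) (zvar k) (d k) (G (k - 1)) (G k))"
proof -
  define VB where "VB i j = {M \<in> bounded_vspins r \<gamma> (r + i).
     (i = 0 \<longrightarrow> M = top_spin r lam c j) \<and> (i = r \<longrightarrow> M = {#})}" for i j
  define HB where "HB i j = {s \<in> hspins r \<gamma>. (j = N + 1 \<longrightarrow> s = Plus) \<and> (j = 0 \<longrightarrow> s = Col (d i))}" for i j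
  let ?VS = "PiE ({0..r} \<times> {0..N}) (\<lambda>p. VB (fst p) (snd p))"
  let ?HS = "PiE ({1..r} \<times> {0..N+1}) (\<lambda>p. HB (fst p) (snd p))"
  let ?sw = "state_weight \<kappa> r \<gamma> N :: _ \<Rightarrow> 'a laurent"
  have finH: "finite ?HS"
    by (intro finite_PiE finite_cartesian_product finite_atLeastAtMost)
       (auto simp: HB_def intro: finite_subset[OF _ finite_hspins])
  have finV: "finite ?VS"
    by (intro finite_PiE finite_cartesian_product finite_atLeastAtMost)
       (auto simp: VB_def intro: finite_subset[OF _ finite_bounded_vspins[OF inj]])
  have sub1: "?HS \<times> ?VS \<subseteq> states r \<gamma> N lam c d"
  proof (rule subrelI)
    fix H V assume HV: "(H, V) \<in> ?HS \<times> ?VS"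
    then have H: "H \<in> ?HS" and V: "V \<in> ?VS" by simp_all
    have "H \<in> {1..r} \<times> {0..N+1} \<rightarrow>\<^sub>E hspins r \<gamma>"
      using H by (rule PiE_mono[THEN subsetD, rotated]) (auto simp: HB_def)
    moreover have "V \<in> {0..r} \<times> {0..N} \<rightarrow>\<^sub>E vspins r \<gamma>"
      using V by (rule PiE_mono[THEN subsetD, rotated])
        (use bounded_vspins_subset in \<open>fastforce simp: VB_def\<close>)
    moreover have "H (i, N + 1) = Plus \<and> H (i, 0) = Col (d i)" if "i \<in> {1..r}" for i
      using PiE_mem[OF H, of "(i, N + 1)"] PiE_mem[OF H, of "(i, 0)"] that
      by (simp add: HB_def)
    moreover have "V (0, j) = top_spin r lam c j \<and> V (r, j) = {#}" if "j \<in> {0..N}" for j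
      using PiE_mem[OF V, of "(0, j)"] PiE_mem[OF V, of "(r, j)"] that
      by (simp add: VB_def)
    ultimately show "(H, V) \<in> states r \<gamma> N lam c d"
      unfolding states_def by blast
  qed
  have sub2: "s \<in> ?HS \<times> ?VS" if "s \<in> states r \<gamma> N lam c d" "?sw s \<noteq> 0" for s
  proof -
    obtain H V where s: "s = (H, V)" by (cases s)
    note st = that(1)[unfolded s] and nz = that(2)[unfolded s]
    have H: "H \<in> {1..r} \<times> {0..N+1} \<rightarrow>\<^sub>E hspins r \<gamma>" and V: "V \<in> {0..r} \<times> {0..N} \<rightarrow>\<^sub>E vspins r \<gamma>"
      and Hb: "\<And>i. i \<in> {1..r} \<Longrightarrow> H (i, N + 1) = Plus \<and> H (i, 0) = Col (d i)"
      and Vb: "\<And>j. j \<in> {0..N} \<Longrightarrow> V (0, j) = top_spin r lam c j \<and> V (r, j) = {#}"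
      using st unfolding states_def by blast+
    have "H p \<in> HB (fst p) (snd p)" if "p \<in> {1..r} \<times> {0..N+1}" for p
      using PiE_mem[OF H that] Hb[of "fst p"] that by (cases p) (auto simp: HB_def)
    moreover have "V p \<in> VB (fst p) (snd p)" if pm: "p \<in> {0..r} \<times> {0..N}" for p
    proof -
      obtain i j where p: "p = (i, j)" "i \<le> r" "j \<le> N" using pm by auto
      show ?thesis
        using PiE_mem[OF V pm] Vb[of j] state_multiplicity_bound[OF st nz p(2,3)] p
        by (auto simp: VB_def bounded_vspins_def vspins_def)
    qed
    ultimately show ?thesis
      unfolding s using H V by (simp add: PiE_iff)
  qed
  have row: "(\<Sum>H\<in>?HS. ?sw (H, V)) =
      (\<Prod>i = 1..r. row_weight \<kappa> r \<gamma> (Suc N) (zvar i) (d i) (\<lambda>j. V (i - 1, j)) (\<lambda>j. V (i, j)))" for V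
  proof -
    let ?w = "\<lambda>i e. \<Prod>j = 0..N. colored_weight \<kappa> r \<gamma> (zvar i :: 'a laurent) (e (j + 1)) (V (i - 1, j)) (e j) (V (i, j))"
    have "(\<Sum>H\<in>?HS. ?sw (H, V)) = (\<Sum>g\<in>PiE {1..r} (\<lambda>i. PiE {0..N+1} (HB i)). \<Prod>i = 1..r. ?w i (g i))"
      unfolding sum_PiE_Times state_weight_def case_prod_conv
      by (intro sum.cong prod.cong refl) auto
    also have "\<dots> = (\<Prod>i = 1..r. \<Sum>e\<in>PiE {0..N+1} (HB i). ?w i e)"
      by (intro prod_sum_PiE[symmetric] finite_atLeastAtMost finite_PiE)
         (auto simp: HB_def intro: finite_subset[OF _ finite_hspins])
    also have "\<dots> = (\<Prod>i = 1..r. row_weight \<kappa> r \<gamma> (Suc N) (zvar i) (d i) (\<lambda>j. V (i - 1, j)) (\<lambda>j. V (i, j)))"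
    proof (intro prod.cong refl)
      fix i
      have "PiE {0..N+1} (HB i) = paths (Suc N) (hspins r \<gamma>) Plus (Col (d i))"
        unfolding paths_def by (auto simp: HB_def PiE_iff extensional_def)
      then show "(\<Sum>e\<in>PiE {0..N+1} (HB i). ?w i e)
          = row_weight \<kappa> r \<gamma> (Suc N) (zvar i) (d i) (\<lambda>j. V (i - 1, j)) (\<lambda>j. V (i, j))"
        unfolding row_weight_def atLeast0AtMost_eq by simp
    qed
    finally show ?thesis .
  qed
  have "(partition_function \<kappa> r \<gamma> N lam c d :: 'a laurent) = (\<Sum>s\<in>?HS \<times> ?VS. ?sw s)"
    unfolding partition_function_def
  proof (rule sum.mono_neutral_left)
    show "finite (?HS \<times> ?VS)"
      using finH finV by (rule finite_cartesian_product)
    show "{s. s \<in> states r \<gamma> N lam c d \<and> ?sw s \<noteq> 0} \<subseteq> ?HS \<times> ?VS"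
      using sub2 by blast
    show "\<forall>s\<in>?HS \<times> ?VS - {s. s \<in> states r \<gamma> N lam c d \<and> ?sw s \<noteq> 0}. ?sw s = 0"
      using sub1 by blast
  qed
  also have "\<dots> = (\<Sum>H\<in>?HS. \<Sum>V\<in>?VS. ?sw (H, V))"
    by (simp add: sum.cartesian_product)
  also have "\<dots> = (\<Sum>V\<in>?VS. \<Sum>H\<in>?HS. ?sw (H, V))"
    by (rule sum.swap)
  also have "\<dots> = (\<Sum>V\<in>?VS. \<Prod>i = 1..r. row_weight \<kappa> r \<gamma> (Suc N) (zvar i) (d i) (\<lambda>j. V (i - 1, j)) (\<lambda>j. V (i, j)))"
    by (simp only: row)
  also have "\<dots> = (\<Sum>G\<in>PiE {0..r} (bounded_row r \<gamma> N lam c).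
       \<Prod>k = 1..r. row_weight \<kappa> r \<gamma> (Suc N) (zvar k) (d k) (G (k - 1)) (G k))"
  proof -
    have "bounded_row r \<gamma> N lam c = (\<lambda>i. PiE {0..N} (VB i))"
      by (intro ext) (simp add: bounded_row_def VB_def[abs_def])
    then show ?thesis
      unfolding sum_PiE_Times by (auto intro!: sum.cong prod.cong row_weight_cong)
  qed
  finally show ?thesis .
qed

section \<open>The weights under exchange of variables, and their membership in
  \<open>laurents r\<close>\<close>

lemma swap_vars_down_weight: "swap_vars i (down_weight \<kappa> n) = down_weight \<kappa> n"
  by (cases \<kappa>) (simp_all add: swap_vars_diff swap_vars_mult swap_vars_power)

lemma swap_vars_up_weight: "swap_vars i (up_weight \<kappa> n) = up_weight \<kappa> n"
  by (cases \<kappa>) (simp_all add: swap_vars_add swap_vars_sum swap_vars_power)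

lemma swap_vars_mono_weight:
  "swap_vars i (mono_weight \<kappa> z g a n b m) = mono_weight \<kappa> (swap_vars i z) g a n b m"
  by (cases a; cases b)
     (simp_all del: mono_weight.simps add: mono_weight_eq swap_vars_mult swap_vars_power
       swap_vars_down_weight swap_vars_up_weight)

lemma swap_vars_row_weight:
  "swap_vars i (row_weight \<kappa> r \<gamma> n z s A D) = row_weight \<kappa> r \<gamma> n (swap_vars i z) s A D"
  by (simp add: row_weight_def colored_weight_def swap_vars_sum swap_vars_prod swap_vars_mono_weight
      del: mono_weight.simps)

lemma swap_vars_two_row_weight:
  "swap_vars i (two_row_weight \<kappa> r \<gamma> n B x y A D s s') =
    two_row_weight \<kappa> r \<gamma> n B (swap_vars i x) (swap_vars i y) A D s s'"
  by (simp add: two_row_weight_def swap_vars_sum swap_vars_mult swap_vars_row_weight)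

lemma laurents_down_weight: "down_weight \<kappa> n \<in> laurents r"
  by (cases \<kappa>) (simp_all add: laurents_diff laurents_1 laurents_mult laurents_power laurents_tvar)

lemma laurents_up_weight: "up_weight \<kappa> n \<in> laurents r"
  by (cases \<kappa>) (simp_all add: laurents_add laurents_1 laurents_sum laurents_power laurents_tvar)

lemma laurents_mono_weight:
  "z \<in> laurents r \<Longrightarrow> mono_weight \<kappa> z g a n b m \<in> laurents r"
  by (cases a; cases b)
     (simp_all del: mono_weight.simps add: mono_weight_eq laurents_0 laurents_1 laurents_mult
       laurents_power laurents_tvar laurents_down_weight laurents_up_weight)

lemma laurents_partition_function: "partition_function \<kappa> r \<gamma> N lam c d \<in> laurents r"
  unfolding partition_function_def state_weight_def colored_weight_def
  by (intro laurents_sum)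
     (auto intro!: laurents_prod laurents_sum laurents_mono_weight laurents_zvar simp del: mono_weight.simps)

section \<open>Isolating two adjacent rows\<close>

definition outer_weight ::
  "weight_kind \<Rightarrow> nat \<Rightarrow> (nat \<Rightarrow> 'c::linorder) \<Rightarrow> nat \<Rightarrow> nat \<Rightarrow> (nat \<Rightarrow> 'c) \<Rightarrow>
   (nat \<Rightarrow> nat \<Rightarrow> 'c multiset) \<Rightarrow> 'a::idom laurent" where
  "outer_weight \<kappa> r \<gamma> n i d G =
     (\<Prod>k\<in>{1..r} - {i, i + 1}. row_weight \<kappa> r \<gamma> n (zvar k) (d k) (G (k - 1)) (G k))"

lemma swap_vars_outer_weight: "swap_vars i (outer_weight \<kappa> r \<gamma> n i d G) = outer_weight \<kappa> r \<gamma> n i d G"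
  unfolding outer_weight_def swap_vars_prod swap_vars_row_weight swap_vars_zvar
  by (intro prod.cong refl) simp

lemma partition_function_eq_two_row:
  fixes \<kappa> :: weight_kind
  assumes inj: "inj_on \<gamma> {1..r}" and i: "1 \<le> i" "i < r"
  shows "(partition_function \<kappa> r \<gamma> N lam c d :: 'a::idom laurent) =
    (\<Sum>G\<in>PiE ({0..r} - {i}) (bounded_row r \<gamma> N lam c). outer_weight \<kappa> r \<gamma> (Suc N) i d G *
       two_row_weight \<kappa> r \<gamma> (Suc N) (r + i) (zvar i) (zvar (i + 1)) (G (i - 1)) (G (i + 1)) (d i) (d (i + 1)))"
proof -
  let ?rw = "row_weight \<kappa> r \<gamma> (Suc N) :: 'a laurent \<Rightarrow> _"
  have rows: "{0..r} = insert i ({0..r} - {i})" using i by auto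
  \<comment> \<open>As 1 \<le> i < r, the edges between the two rows are interior and both boundary
    conditions are vacuous.\<close>
  have mid: "bounded_row r \<gamma> N lam c i = {..<Suc N} \<rightarrow>\<^sub>E bounded_vspins r \<gamma> (r + i)"
    unfolding bounded_row_def atLeast0AtMost_eq using i by simp
  have split: "(\<Prod>k = 1..r. ?rw (zvar k) (d k) ((G(i := M)) (k - 1)) ((G(i := M)) k)) =
      outer_weight \<kappa> r \<gamma> (Suc N) i d G *
      (?rw (zvar i) (d i) (G (i - 1)) M * ?rw (zvar (i + 1)) (d (i + 1)) M (G (i + 1)))" for G M
  proof -
    have "{1..r} = insert i (insert (i + 1) ({1..r} - {i, i + 1}))" using i by auto
    then have "(\<Prod>k = 1..r. ?rw (zvar k) (d k) ((G(i := M)) (k - 1)) ((G(i := M)) k)) =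
      (\<Prod>k\<in>insert i (insert (i + 1) ({1..r} - {i, i + 1})).
        ?rw (zvar k) (d k) ((G(i := M)) (k - 1)) ((G(i := M)) k))"
      by simp
    also have "\<dots> = ?rw (zvar i) (d i) (G (i - 1)) M * (?rw (zvar (i + 1)) (d (i + 1)) M (G (i + 1)) *
      (\<Prod>k\<in>{1..r} - {i, i + 1}. ?rw (zvar k) (d k) ((G(i := M)) (k - 1)) ((G(i := M)) k)))"
      using i by (subst prod.insert; (subst prod.insert)?) auto
    also have "(\<Prod>k\<in>{1..r} - {i, i + 1}. ?rw (zvar k) (d k) ((G(i := M)) (k - 1)) ((G(i := M)) k))
        = outer_weight \<kappa> r \<gamma> (Suc N) i d G"
      unfolding outer_weight_def by (intro prod.cong refl) auto
    finally show ?thesis by (simp only: mult_ac)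
  qed
  show ?thesis
    unfolding partition_function_eq_sum_rows[OF inj]
    by (subst rows, subst sum_PiE_insert)
       (simp_all only: split mid two_row_weight_def sum_distrib_left insert_Diff_if, auto)
qed

text \<open>Holds term by term in the vertical spins other than those between rows i and i + 1.
  Exchanging the variables fixes the outer weight and interchanges the parameters of the two
  isolated rows, which yields the primed vector; exchanging the two boundary colors affects only
  these rows as well.\<close>

lemma demazure_lusztig_partition_function:
  fixes \<gamma> :: "nat \<Rightarrow> 'c::linorder"
  assumes anti: "strict_antimono_on {1..r} \<gamma>" and i: "1 \<le> i" "i < r"
    and d: "d i \<in> \<gamma> ` {1..r}" "d (i + 1) \<in> \<gamma> ` {1..r}" "d (i + 1) < d i"
  shows "demazure_lusztig i (partition_function \<kappa> r \<gamma> N lam c d :: 'a::idom laurent)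
    = partition_function \<kappa> r \<gamma> N lam c (flag_act (simple_refl i) d)"
proof (rule demazure_lusztig_eqI)
  let ?x = "zvar i :: 'a laurent" and ?y = "zvar (i + 1) :: 'a laurent" and ?t = "tvar :: 'a laurent"
  let ?T = "\<lambda>x y G. two_row_weight \<kappa> r \<gamma> (Suc N) (r + i) x y (G (i - 1)) (G (i + 1))"
  let ?W = "outer_weight \<kappa> r \<gamma> (Suc N) i d :: _ \<Rightarrow> 'a laurent"
  let ?R = "PiE ({0..r} - {i}) (bounded_row r \<gamma> N lam c)"
  let ?d' = "flag_act (simple_refl i) d"
  have inj: "inj_on \<gamma> {1..r}"
  proof (rule linorder_inj_onI)
    fix a b assume "a < b" "a \<in> {1..r}" "b \<in> {1..r}"
    then have "\<gamma> b < \<gamma> a" using anti unfolding monotone_on_def by blast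
    then show "\<gamma> a \<noteq> \<gamma> b" by simp
  qed auto
  note Z = partition_function_eq_two_row[OF inj i, where \<kappa> = \<kappa> and N = N and lam = lam and c = c]
  have d': "?d' i = d (i + 1)" "?d' (i + 1) = d i" "k \<noteq> i \<Longrightarrow> k \<noteq> i + 1 \<Longrightarrow> ?d' k = d k" for k
    by (simp_all add: flag_act_def)
  have W': "outer_weight \<kappa> r \<gamma> (Suc N) i ?d' G = ?W G" for G
    unfolding outer_weight_def
  proof (intro prod.cong refl)
    fix k assume "k \<in> {1..r} - {i, i + 1}"
    then have "?d' k = d k" by (intro d'(3)) auto
    then show "row_weight \<kappa> r \<gamma> (Suc N) (zvar k :: 'a laurent) (?d' k) (G (k - 1)) (G k)
        = row_weight \<kappa> r \<gamma> (Suc N) (zvar k) (d k) (G (k - 1)) (G k)"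
      by (simp only:)
  qed
  have Zd: "partition_function \<kappa> r \<gamma> N lam c d = (\<Sum>G\<in>?R. ?W G * ?T ?x ?y G (d i) (d (i + 1)))"
    by (rule Z)
  have Zd': "partition_function \<kappa> r \<gamma> N lam c ?d' = (\<Sum>G\<in>?R. ?W G * ?T ?x ?y G (d (i + 1)) (d i))"
    unfolding Z d' W' ..
  have swap: "swap_vars i (partition_function \<kappa> r \<gamma> N lam c d)
      = (\<Sum>G\<in>?R. ?W G * ?T ?y ?x G (d i) (d (i + 1)))"
    unfolding Zd swap_vars_sum swap_vars_mult swap_vars_outer_weight swap_vars_two_row_weight swap_vars_zvar
    by simp
  have rel: "(?x - ?y) * ?T ?x ?y G (d (i + 1)) (d i)
      = (1 - ?t) * ?y * ?T ?x ?y G (d i) (d (i + 1)) - (?y - ?t * ?x) * ?T ?y ?x G (d i) (d (i + 1))"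
    if G: "G \<in> ?R" for G
  proof -
    \<comment> \<open>The bound for the edges above is smaller by one, which gives the strict
      inequality that keeps the column sums exact.\<close>
    have "count (G (i - 1) j) g < r + i" if "j < Suc N" for j g
    proof -
      have "i - 1 \<in> {0..r} - {i}" using i by auto
      from PiE_mem[OF PiE_mem[OF G this, unfolded bounded_row_def], of j]
      have "G (i - 1) j \<in> bounded_vspins r \<gamma> (r + (i - 1))"
        using that by simp
      then have "count (G (i - 1) j) g \<le> r + (i - 1)" by (simp add: bounded_vspins_def)
      then show ?thesis using i by simp
    qed
    moreover have "?x \<noteq> ?y" by (simp add: inj_zvar)
    ultimately show ?thesis
      using two_row_weight_exch[OF anti inj, of ?x ?y "Suc N" "G (i - 1)" "r + i" "d i" "d (i + 1)" \<kappa> "G (i + 1)"] d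
      unfolding exch_def by simp
  qed
  show "(?x - ?y) * partition_function \<kappa> r \<gamma> N lam c ?d'
      = (1 - ?t) * ?y * partition_function \<kappa> r \<gamma> N lam c d
        - (?y - ?t * ?x) * swap_vars i (partition_function \<kappa> r \<gamma> N lam c d)"
  proof -
    have "(?x - ?y) * partition_function \<kappa> r \<gamma> N lam c ?d'
        = (\<Sum>G\<in>?R. ?W G * ((?x - ?y) * ?T ?x ?y G (d (i + 1)) (d i)))"
      unfolding Zd' sum_distrib_left by (simp only: mult.left_commute)
    also have "\<dots> = (\<Sum>G\<in>?R. ?W G * ((1 - ?t) * ?y * ?T ?x ?y G (d i) (d (i + 1))
        - (?y - ?t * ?x) * ?T ?y ?x G (d i) (d (i + 1))))"
      by (intro sum.cong refl) (simp only: rel)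
    also have "\<dots> = (\<Sum>G\<in>?R. (1 - ?t) * ?y * (?W G * ?T ?x ?y G (d i) (d (i + 1)))
        - (?y - ?t * ?x) * (?W G * ?T ?y ?x G (d i) (d (i + 1))))"
      by (intro sum.cong refl) (simp only: right_diff_distrib mult.left_commute mult.assoc)
    finally show ?thesis
      by (simp only: Zd swap[unfolded Zd] sum_subtractf sum_distrib_left)
  qed
qed

theorem proposition4p5:
  fixes r N i :: nat
    and \<gamma> c d :: "nat \<Rightarrow> 'c::linorder"
    and lam w :: "nat \<Rightarrow> nat"
    and \<kappa> :: weight_kind
  assumes "r \<ge> 1"
    and "strict_antimono_on {1..r} \<gamma>"
    and "antimono_on {1..r} lam"
    and "lam 1 \<le> N"
    and "proper_flag r \<gamma> c"
    and "proper_flag r \<gamma> d"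
    and "w permutes {1..r}"
    and "\<forall>j \<in> {1..r}. d j = flag_act w \<gamma> j"
    and "1 \<le> i" and "i < r"
  shows "(bruhat_less r w (simple_refl i \<circ> w) \<longrightarrow>
            (partition_function \<kappa> r \<gamma> N lam c (flag_act (simple_refl i) d) :: 'a::idom laurent)
              = demazure_lusztig i (partition_function \<kappa> r \<gamma> N lam c d))
       \<and> (bruhat_less r (simple_refl i \<circ> w) w \<longrightarrow>
            (partition_function \<kappa> r \<gamma> N lam c (flag_act (simple_refl i) d) :: 'a laurent)
              = demazure_lusztig_inv r i (partition_function \<kappa> r \<gamma> N lam c d))"
proof -
  let ?s = "simple_refl i" and ?Z = "\<lambda>d. partition_function \<kappa> r \<gamma> N lam c d :: 'a laurent"
  let ?u = "?s \<circ> w"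
  have mem: "i \<in> {1..<r}" "i \<in> {1..r}" "i + 1 \<in> {1..r}" using assms(9,10) by auto
  have inv_w: "inv w permutes {1..r}" by (rule permutes_inv[OF assms(7)])
  have inv_mem: "inv w i \<in> {1..r}" "inv w (i + 1) \<in> {1..r}"
    using mem permutes_in_image[OF inv_w] by blast+
  have neq: "inv w i \<noteq> inv w (i + 1)"
    using injD[OF permutes_inj[OF inv_w], of i "i + 1"] by auto
  have d: "d i = \<gamma> (inv w i)" "d (i + 1) = \<gamma> (inv w (i + 1))"
    using assms(8) mem by (auto simp: flag_act_def)
  have d_mem: "d i \<in> \<gamma> ` {1..r}" "d (i + 1) \<in> \<gamma> ` {1..r}"
    unfolding d using inv_mem by blast+
  have less: "\<gamma> b < \<gamma> a" if "a \<in> {1..r}" "b \<in> {1..r}" "a < b" for a b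
    using assms(2) that unfolding monotone_on_def by blast
  have ascent: "demazure_lusztig i (?Z d) = ?Z (flag_act ?s d)" if "bruhat_less r w ?u"
  proof -
    have "inv w i \<le> inv w (i + 1)"
      by (rule cox_length_less_imp[OF mem(1) bruhat_less_cox_length[OF that]])
    then have "d (i + 1) < d i"
      unfolding d using neq inv_mem by (intro less) auto
    then show ?thesis
      by (rule demazure_lusztig_partition_function[OF assms(2,9,10) d_mem])
  qed
  have descent: "?Z (flag_act ?s d) = demazure_lusztig_inv r i (?Z d)" if "bruhat_less r ?u w"
  proof -
    let ?d' = "flag_act ?s d"
    \<comment> \<open>A descent of w is an ascent of s_i w, so the ascent relation applies to the
      flag \<open>?d'\<close>, from which s_i leads back to \<open>d\<close>.\<close>
    have su: "?s \<circ> ?u = w" by (simp add: fun_eq_iff)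
    have "bruhat_less r ?u (?s \<circ> ?u)" unfolding su by (rule that)
    then have "inv ?u i \<le> inv ?u (i + 1)"
      by (intro cox_length_less_imp[OF mem(1)] bruhat_less_cox_length)
    moreover have "inv ?u = inv w \<circ> ?s"
      using o_inv_distrib[OF bij_transpose permutes_bij[OF assms(7)]] by simp
    ultimately have "inv w (i + 1) \<le> inv w i" by simp
    then have "d i < d (i + 1)"
      unfolding d using neq inv_mem by (intro less) auto
    then have "demazure_lusztig i (?Z ?d') = ?Z (flag_act ?s ?d')"
      by (intro demazure_lusztig_partition_function[OF assms(2,9,10)])
         (simp_all add: flag_act_def d_mem[simplified])
    moreover have "flag_act ?s ?d' = d"
      by (simp add: flag_act_def fun_eq_iff)
    ultimately have "?Z d = demazure_lusztig i (?Z ?d')" by simp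
    \<comment> \<open>\<open>inv_into\<close> returns the partition function of \<open>?d'\<close>
      because it lies in \<open>laurents r\<close> and the operator is injective.\<close>
    then show ?thesis
      unfolding demazure_lusztig_inv_def
      by (simp add: inv_into_f_f[OF inj_on_subset[OF inj_demazure_lusztig]] laurents_partition_function)
  qed
  show ?thesis using ascent descent by auto
qed

end
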